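(* Let $G$ be a discrete group with identity $\varepsilon$, let $R$ be a commutative ring with identity, let $\mathcal{G}$ be a $G$-graded ample Hausdorff groupoid, and let $U\subseteq \mathcal{G}^{(0)}$ be an open invariant subset. Let $\pi=(\pi_B, C_R(U_B), C_R(U))_{B\in\mathcal{G}^{(h)}}$ be the induced partial action of the inverse semigroup $\mathcal{G}^{(h)}$ on $C_R(U)$ (described in the context). Then there is an isomorphism of $G$-graded $R$-algebras $$A_R(\mathcal{G}_U)\cong_{\operatorname{gr}} C_R(U)\rtimes_{\pi}\mathcal{G}^{(h)},$$ given on generators by $1_D\mapsto 1_{r(D)}\delta_D$ for graded compact open bisections $D$ of $\mathcal{G}_U$. In particular, $A_R(\mathcal{G})\cong_{\operatorname{gr}} C_R(\mathcal{G}^{(0)})\rtimes_{\pi}\mathcal{G}^{(h)}$.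
   Context: Groupoid notation: $d(x)=x^{-1}x$, $r(x)=xx^{-1}$; a subset $U\subseteq\mathcal{G}^{(0)}$ is invariant if $d(\gamma)\in U$ implies $r(\gamma)\in U$. A topological groupoid is ample if it is étale (the domain map is a local homeomorphism) and has a basis of compact open bisections (open sets on which $r$ and $d$ are homeomorphisms onto open subsets of $\mathcal{G}^{(0)}$). A $G$-grading of $\mathcal{G}$ is a continuous map $c:\mathcal{G}\to G$ with $c(\alpha\beta)=c(\alpha)c(\beta)$ for composable pairs; write $\mathcal{G}_g=c^{-1}(g)$. $\mathcal{G}_U:=d^{-1}(U)$, an open subgroupoid (also equal to $r^{-1}(U)$ by invariance). Steinberg algebra: for an ample Hausdorff groupoid $\mathcal{H}$, $A_R(\mathcal{H})$ is the $R$-module of compactly supported locally constant functions $\mathcal{H}\to R$ with pointwise addition and convolution $(f*g)(\gamma)=\sum_{\alpha\beta=\gamma}f(\alpha)g(\beta)$; it is spanned by characteristic functions $1_B$ of compact open bisections, and $1_B*1_C=1_{BC}$. If $\mathcal{H}$ is $G$-graded, $A_R(\mathcal{H})$ is $G$-graded with $A_R(\mathcal{H})_g=\{f:\operatorname{supp}(f)\subseteq\mathcal{H}_g\}$. For a Hausdorff space $Y$, $C_R(Y)$ is the commutative $R$-algebra (pointwise operations) of compactly supported locally constant functions $Y\to R$; for an open $W\subseteq Y$, $C_R(W)$ is identified with the ideal of functions in $C_R(Y)$ vanishing outside $W$. $\mathcal{G}^{(h)}$ is the set of compact open bisections $B$ of $\mathcal{G}$ with $B\subseteq\mathcal{G}_g$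 for some $g$ (including $\emptyset$); it is an inverse semigroup under $BC=\{\beta\gamma:\beta\in B,\gamma\in C, d(\beta)=r(\gamma)\}$ with $B^*=B^{-1}$, and $B\le C$ iff $B\subseteq C$. For $B\in\mathcal{G}^{(h)}$ let $U_B=r(B)\cap U$, $U_{B^{-1}}=d(B)\cap U$, and $\pi_B:U_{B^{-1}}\to U_B$, $\pi_B(d(b))=r(b)$ for $b\in B$. The induced partial action on $C_R(U)$ has ideals $C_R(U_B)$ and isomorphisms $\pi_B:C_R(U_{B^{-1}})\to C_R(U_B)$, $\pi_B(f)=f\circ\pi_B^{-1}$. Partial skew inverse semigroup ring: for a partial action $(\pi_s,A_s,A)_{s\in\mathcal{S}}$ of an inverse semigroup $\mathcal{S}$ on an algebra $A$, let $\mathcal{L}$ be the set of finite formal sums $\sum_s a_s\delta_s$ with $a_s\in A_s$, with multiplication extending $(a_s\delta_s)(a_t\delta_t)=\pi_s(\pi_{s^*}(a_s)a_t)\delta_{st}$; then $A\rtimes_\pi\mathcal{S}:=\mathcal{L}/\mathcal{N}$, where $\mathcal{N}$ is the ideal generated by all $a\delta_s-a\delta_t$ with $s\le t$ and $a\in A_s$. Here $C_R(U)\rtimes_\pi\mathcal{G}^{(h)}$ is $G$-graded by declaring $a\delta_B$ homogeneous of degree $g$ when $\emptyset\ne B\subseteq\mathcal{G}_g$. *)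

theory Defs
  imports "HOL-Analysis.Analysis"
begin

record 'a gpd =
  gtop :: "'a topology"
  dm   :: "'a \<Rightarrow> 'a"
  rg   :: "'a \<Rightarrow> 'a"
  mul  :: "'a \<Rightarrow> 'a \<Rightarrow> 'a"
  iv   :: "'a \<Rightarrow> 'a"

definition arrows :: "('a, 'b) gpd_scheme \<Rightarrow> 'a set" where
  "arrows G = topspace (gtop G)"

text \<open>Unit space G0 (units are identified with identity arrows, d x = x^-1 x).\<close>
definition units :: "('a, 'b) gpd_scheme \<Rightarrow> 'a set" where
  "units G = dm G ` arrows G"

definition composable_pairs :: "('a, 'b) gpd_scheme \<Rightarrow> ('a \<times> 'a) set" where
  "composable_pairs G = {(a, b). a \<in> arrows G \<and> b \<in> arrows G \<and> dm G a = rg G b}"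

definition groupoid :: "('a, 'b) gpd_scheme \<Rightarrow> bool" where
  "groupoid G \<longleftrightarrow>
     (\<forall>a\<in>arrows G. dm G a \<in> arrows G \<and> rg G a \<in> arrows G \<and> iv G a \<in> arrows G) \<and>
     (\<forall>a\<in>arrows G. dm G (dm G a) = dm G a \<and> rg G (dm G a) = dm G a \<and>
                    dm G (rg G a) = rg G a \<and> rg G (rg G a) = rg G a) \<and>
     (\<forall>a\<in>arrows G. \<forall>b\<in>arrows G. dm G a = rg G b \<longrightarrow>
          mul G a b \<in> arrows G \<and> dm G (mul G a b) = dm G b \<and> rg G (mul G a b) = rg G a) \<and>
     (\<forall>a\<in>arrows G. \<forall>b\<in>arrows G. \<forall>c\<in>arrows G. dm G a = rg G b \<and> dm G b = rg G c \<longrightarrow>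
          mul G (mul G a b) c = mul G a (mul G b c)) \<and>
     (\<forall>a\<in>arrows G. mul G (rg G a) a = a \<and> mul G a (dm G a) = a) \<and>
     (\<forall>a\<in>arrows G. dm G (iv G a) = rg G a \<and> rg G (iv G a) = dm G a \<and>
                    mul G (iv G a) a = dm G a \<and> mul G a (iv G a) = rg G a)"

definition topological_groupoid :: "('a, 'b) gpd_scheme \<Rightarrow> bool" where
  "topological_groupoid G \<longleftrightarrow>
     groupoid G \<and>
     continuous_map (gtop G) (gtop G) (iv G) \<and>
     continuous_map (subtopology (prod_topology (gtop G) (gtop G)) (composable_pairs G))
                    (gtop G) (\<lambda>(a, b). mul G a b)"

definition bisection :: "('a, 'b) gpd_scheme \<Rightarrow> 'a set \<Rightarrow> bool" where
  "bisection G B \<longleftrightarrow>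
     openin (gtop G) B \<and>
     openin (subtopology (gtop G) (units G)) (dm G ` B) \<and>
     openin (subtopology (gtop G) (units G)) (rg G ` B) \<and>
     homeomorphic_map (subtopology (gtop G) B) (subtopology (gtop G) (dm G ` B)) (dm G) \<and>
     homeomorphic_map (subtopology (gtop G) B) (subtopology (gtop G) (rg G ` B)) (rg G)"

definition compact_open_bisection :: "('a, 'b) gpd_scheme \<Rightarrow> 'a set \<Rightarrow> bool" where
  "compact_open_bisection G B \<longleftrightarrow> bisection G B \<and> compactin (gtop G) B"

definition etale :: "('a, 'b) gpd_scheme \<Rightarrow> bool" where
  "etale G \<longleftrightarrow>
     (\<forall>x\<in>arrows G. \<exists>V. openin (gtop G) V \<and> x \<in> V \<and>
        openin (subtopology (gtop G) (units G)) (dm G ` V) \<and>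
        homeomorphic_map (subtopology (gtop G) V) (subtopology (gtop G) (dm G ` V)) (dm G))"

definition ample :: "('a, 'b) gpd_scheme \<Rightarrow> bool" where
  "ample G \<longleftrightarrow> etale G \<and>
     (\<forall>W x. openin (gtop G) W \<and> x \<in> W \<longrightarrow>
        (\<exists>B. compact_open_bisection G B \<and> x \<in> B \<and> B \<subseteq> W))"

text \<open>A grading by a discrete group (written additively; identity is 0):
  continuity into a discrete group means every fibre is open.\<close>
definition grading :: "('a, 'b) gpd_scheme \<Rightarrow> ('a \<Rightarrow> 'g::group_add) \<Rightarrow> bool" where
  "grading G c \<longleftrightarrow>
     (\<forall>g. openin (gtop G) {a \<in> arrows G. c a = g}) \<and>
     (\<forall>a\<in>arrows G. \<forall>b\<in>arrows G. dm G a = rg G b \<longrightarrow> c (mul G a b) = c a + c b)"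

definition invariant :: "('a, 'b) gpd_scheme \<Rightarrow> 'a set \<Rightarrow> bool" where
  "invariant G U \<longleftrightarrow> (\<forall>x\<in>arrows G. dm G x \<in> U \<longrightarrow> rg G x \<in> U)"

definition reduce :: "('a, 'b) gpd_scheme \<Rightarrow> 'a set \<Rightarrow> ('a, 'b) gpd_scheme" where
  "reduce G U = G\<lparr>gtop := subtopology (gtop G) {x \<in> arrows G. dm G x \<in> U}\<rparr>"

definition CR :: "'a topology \<Rightarrow> ('a \<Rightarrow> 'r::comm_ring_1) set" where
  "CR X = {f. (\<forall>x. x \<notin> topspace X \<longrightarrow> f x = 0) \<and>
              (\<forall>x\<in>topspace X. \<exists>V. openin X V \<and> x \<in> V \<and> (\<forall>y\<in>V. f y = f x)) \<and>
              compactin X (X closure_of {x \<in> topspace X. f x \<noteq> 0})}"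

definition steinberg :: "('a, 'b) gpd_scheme \<Rightarrow> ('a \<Rightarrow> 'r::comm_ring_1) set" where
  "steinberg H = CR (gtop H)"

text \<open>Convolution (f*g)(gamma) = sum over alpha beta = gamma of f alpha g beta,
  written with alpha ranging over r^-1(r gamma) (so beta = alpha^-1 gamma).\<close>
definition conv :: "('a, 'b) gpd_scheme \<Rightarrow> ('a \<Rightarrow> 'r::comm_ring_1) \<Rightarrow> ('a \<Rightarrow> 'r) \<Rightarrow> 'a \<Rightarrow> 'r" where
  "conv H f g \<gamma> =
     (if \<gamma> \<in> arrows H
      then (\<Sum>\<alpha> \<in> {\<alpha> \<in> arrows H. rg H \<alpha> = rg H \<gamma> \<and> f \<alpha> \<noteq> 0}. f \<alpha> * g (mul H (iv H \<alpha>) \<gamma>))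
      else 0)"

definition steinberg_deg :: "('a, 'b) gpd_scheme \<Rightarrow> ('a \<Rightarrow> 'g) \<Rightarrow> 'g \<Rightarrow> ('a \<Rightarrow> 'r::comm_ring_1) set" where
  "steinberg_deg H c g = {f \<in> steinberg H. \<forall>x. f x \<noteq> 0 \<longrightarrow> c x = g}"

definition Gh :: "('a, 'b) gpd_scheme \<Rightarrow> ('a \<Rightarrow> 'g) \<Rightarrow> 'a set set" where
  "Gh G c = {B. B = {} \<or> (compact_open_bisection G B \<and> (\<exists>g. \<forall>b\<in>B. c b = g))}"

definition setmult :: "('a, 'b) gpd_scheme \<Rightarrow> 'a set \<Rightarrow> 'a set \<Rightarrow> 'a set" where
  "setmult G B C = {mul G b x | b x. b \<in> B \<and> x \<in> C \<and> dm G b = rg G x}"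

definition setinv :: "('a, 'b) gpd_scheme \<Rightarrow> 'a set \<Rightarrow> 'a set" where
  "setinv G B = iv G ` B"

text \<open>The ideal C_R(U_B) of C_R(U), U_B = r(B) \<inter> U.\<close>
definition Aideal :: "('a, 'b) gpd_scheme \<Rightarrow> 'a set \<Rightarrow> 'a set \<Rightarrow> ('a \<Rightarrow> 'r::comm_ring_1) set" where
  "Aideal G U B = {f \<in> CR (subtopology (gtop G) U). \<forall>x. x \<notin> rg G ` B \<inter> U \<longrightarrow> f x = 0}"

text \<open>pi_B(f) = f o pi_B^-1, where pi_B(d b) = r b.\<close>
definition piB :: "('a, 'b) gpd_scheme \<Rightarrow> 'a set \<Rightarrow> 'a set \<Rightarrow> ('a \<Rightarrow> 'r::comm_ring_1) \<Rightarrow> 'a \<Rightarrow> 'r" where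
  "piB G U B f = (\<lambda>x. if x \<in> rg G ` B \<inter> U then f (dm G (THE b. b \<in> B \<and> rg G b = x)) else 0)"

text \<open>Finite formal sums sum_s a_s delta_s, represented by their coefficient maps.\<close>
definition skewL :: "('a, 'b) gpd_scheme \<Rightarrow> ('a \<Rightarrow> 'g) \<Rightarrow> 'a set \<Rightarrow> ('a set \<Rightarrow> 'a \<Rightarrow> 'r::comm_ring_1) set" where
  "skewL G c U = {x. finite {s. x s \<noteq> (\<lambda>_. 0)} \<and>
       (\<forall>s. (s \<in> Gh G c \<longrightarrow> x s \<in> Aideal G U s) \<and> (s \<notin> Gh G c \<longrightarrow> x s = (\<lambda>_. 0)))}"

definition skew_delta :: "'a set \<Rightarrow> ('a \<Rightarrow> 'r::comm_ring_1) \<Rightarrow> 'a set \<Rightarrow> 'a \<Rightarrow> 'r" where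
  "skew_delta s a = (\<lambda>t. if t = s then a else (\<lambda>_. 0))"

definition skew_zero :: "'a set \<Rightarrow> 'a \<Rightarrow> 'r::comm_ring_1" where
  "skew_zero = (\<lambda>s z. 0)"

definition skew_add :: "('a set \<Rightarrow> 'a \<Rightarrow> 'r::comm_ring_1) \<Rightarrow> ('a set \<Rightarrow> 'a \<Rightarrow> 'r) \<Rightarrow> 'a set \<Rightarrow> 'a \<Rightarrow> 'r" where
  "skew_add x y = (\<lambda>s z. x s z + y s z)"

definition skew_neg :: "('a set \<Rightarrow> 'a \<Rightarrow> 'r::comm_ring_1) \<Rightarrow> 'a set \<Rightarrow> 'a \<Rightarrow> 'r" where
  "skew_neg x = (\<lambda>s z. - x s z)"

definition skew_smul :: "'r::comm_ring_1 \<Rightarrow> ('a set \<Rightarrow> 'a \<Rightarrow> 'r) \<Rightarrow> 'a set \<Rightarrow> 'a \<Rightarrow> 'r" where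
  "skew_smul k x = (\<lambda>s z. k * x s z)"

text \<open>(a_s delta_s)(a_t delta_t) = pi_s(pi_{s*}(a_s) a_t) delta_{st}, extended bilinearly.\<close>
definition skew_mult :: "('a, 'b) gpd_scheme \<Rightarrow> 'a set \<Rightarrow>
    ('a set \<Rightarrow> 'a \<Rightarrow> 'r::comm_ring_1) \<Rightarrow> ('a set \<Rightarrow> 'a \<Rightarrow> 'r) \<Rightarrow> 'a set \<Rightarrow> 'a \<Rightarrow> 'r" where
  "skew_mult G U x y = (\<lambda>u z.
     \<Sum>(s, t) \<in> {(s, t). x s \<noteq> (\<lambda>_. 0) \<and> y t \<noteq> (\<lambda>_. 0) \<and> setmult G s t = u}.
        piB G U s (\<lambda>w. piB G U (setinv G s) (x s) w * y t w) z)"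

inductive_set skewN :: "('a, 'b) gpd_scheme \<Rightarrow> ('a \<Rightarrow> 'g) \<Rightarrow> 'a set \<Rightarrow> ('a set \<Rightarrow> 'a \<Rightarrow> 'r::comm_ring_1) set"
  for G :: "('a, 'b) gpd_scheme" and c :: "'a \<Rightarrow> 'g" and U :: "'a set" where
  gen: "s \<in> Gh G c \<Longrightarrow> t \<in> Gh G c \<Longrightarrow> s \<subseteq> t \<Longrightarrow> a \<in> Aideal G U s \<Longrightarrow>
          skew_add (skew_delta s a) (skew_neg (skew_delta t a)) \<in> skewN G c U"
| zero: "skew_zero \<in> skewN G c U"
| add: "x \<in> skewN G c U \<Longrightarrow> y \<in> skewN G c U \<Longrightarrow> skew_add x y \<in> skewN G c U"
| neg: "x \<in> skewN G c U \<Longrightarrow> skew_neg x \<in> skewN G c U"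
| smul: "x \<in> skewN G c U \<Longrightarrow> skew_smul k x \<in> skewN G c U"
| left: "x \<in> skewN G c U \<Longrightarrow> l \<in> skewL G c U \<Longrightarrow> skew_mult G U l x \<in> skewN G c U"
| right: "x \<in> skewN G c U \<Longrightarrow> l \<in> skewL G c U \<Longrightarrow> skew_mult G U x l \<in> skewN G c U"

definition skew_class :: "('a, 'b) gpd_scheme \<Rightarrow> ('a \<Rightarrow> 'g) \<Rightarrow> 'a set \<Rightarrow>
    ('a set \<Rightarrow> 'a \<Rightarrow> 'r::comm_ring_1) \<Rightarrow> ('a set \<Rightarrow> 'a \<Rightarrow> 'r) set" where
  "skew_class G c U x = {y \<in> skewL G c U. skew_add x (skew_neg y) \<in> skewN G c U}"

definition skew_quot :: "('a, 'b) gpd_scheme \<Rightarrow> ('a \<Rightarrow> 'g) \<Rightarrow> 'a set \<Rightarrow>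
    ('a set \<Rightarrow> 'a \<Rightarrow> 'r::comm_ring_1) set set" where
  "skew_quot G c U = skew_class G c U ` skewL G c U"

definition qrep :: "'x set \<Rightarrow> 'x" where
  "qrep X = (SOME x. x \<in> X)"

definition quot_add :: "('a, 'b) gpd_scheme \<Rightarrow> ('a \<Rightarrow> 'g) \<Rightarrow> 'a set \<Rightarrow>
    ('a set \<Rightarrow> 'a \<Rightarrow> 'r::comm_ring_1) set \<Rightarrow> ('a set \<Rightarrow> 'a \<Rightarrow> 'r) set \<Rightarrow> ('a set \<Rightarrow> 'a \<Rightarrow> 'r) set" where
  "quot_add G c U X Y = skew_class G c U (skew_add (qrep X) (qrep Y))"

definition quot_smul :: "('a, 'b) gpd_scheme \<Rightarrow> ('a \<Rightarrow> 'g) \<Rightarrow> 'a set \<Rightarrow>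
    'r::comm_ring_1 \<Rightarrow> ('a set \<Rightarrow> 'a \<Rightarrow> 'r) set \<Rightarrow> ('a set \<Rightarrow> 'a \<Rightarrow> 'r) set" where
  "quot_smul G c U k X = skew_class G c U (skew_smul k (qrep X))"

definition quot_mult :: "('a, 'b) gpd_scheme \<Rightarrow> ('a \<Rightarrow> 'g) \<Rightarrow> 'a set \<Rightarrow>
    ('a set \<Rightarrow> 'a \<Rightarrow> 'r::comm_ring_1) set \<Rightarrow> ('a set \<Rightarrow> 'a \<Rightarrow> 'r) set \<Rightarrow> ('a set \<Rightarrow> 'a \<Rightarrow> 'r) set" where
  "quot_mult G c U X Y = skew_class G c U (skew_mult G U (qrep X) (qrep Y))"

definition skewL_deg :: "('a, 'b) gpd_scheme \<Rightarrow> ('a \<Rightarrow> 'g) \<Rightarrow> 'a set \<Rightarrow> 'g \<Rightarrow>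
    ('a set \<Rightarrow> 'a \<Rightarrow> 'r::comm_ring_1) set" where
  "skewL_deg G c U g = {x \<in> skewL G c U. \<forall>s. x s \<noteq> (\<lambda>_. 0) \<longrightarrow> s \<noteq> {} \<and> (\<forall>b\<in>s. c b = g)}"

definition quot_deg :: "('a, 'b) gpd_scheme \<Rightarrow> ('a \<Rightarrow> 'g) \<Rightarrow> 'a set \<Rightarrow> 'g \<Rightarrow>
    ('a set \<Rightarrow> 'a \<Rightarrow> 'r::comm_ring_1) set set" where
  "quot_deg G c U g = skew_class G c U ` skewL_deg G c U g"

end

theory Submission
  imports Defs
begin

text \<open>Evaluation of a formal sum, \<open>\<Sum> a\<^sub>s \<delta>\<^sub>s \<mapsto> (\<gamma> \<mapsto> \<Sum> {a\<^sub>s (r \<gamma>) | \<gamma> \<in> s})\<close>, is multiplicative because a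
  factorisation \<open>\<gamma> = \<beta> \<tau>\<close> with \<open>\<beta> \<in> s\<close> and \<open>\<tau> \<in> t\<close> is unique when it exists.  It is onto because the
  support of \<open>f\<close> is covered by finitely many graded compact open bisections, from which \<open>f\<close> can be peeled
  off one at a time.  Its kernel is exactly the ideal: the finitely many bisections of a formal sum have
  clopen atoms, the sum can be rewritten modulo the ideal with the disjoint atoms as its support, and there
  evaluation determines each coefficient.  The isomorphism sends \<open>f\<close> to its fibre under evaluation.\<close>

section \<open>Compactly supported locally constant functions\<close>

text \<open>The Hausdorff property makes every compact open bisection closed. Hence extension by
  zero preserves local constancy, and clopen pieces of a bisection are again compact open
  bisections, which is what the atoms need. Evaluation kills the ideal because it is multiplicative;
  in the other direction no products occur, since an element of the kernel is written outright as a
  sum of negated generators. Once ideal and kernel agree, cosets are fibres of evaluation. The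
  operations on the quotient are defined through chosen representatives, and their compatibility
  with the isomorphism follows without a separate proof that they are well defined. The grading
  constrains the covers: each bisection has to lie in one degree and to meet the support of the
  function, so that a homogeneous function lifts to a homogeneous formal sum.\<close>

lemma locally_constant_openin:
  assumes "\<And>x. x \<in> topspace X \<Longrightarrow> \<exists>V. openin X V \<and> x \<in> V \<and> (\<forall>y\<in>V. f y = f x)"
  shows "openin X {x \<in> topspace X. P (f x)}"
proof (subst openin_subopen, clarify)
  fix x assume x: "x \<in> topspace X" "P (f x)"
  then obtain V where V: "openin X V" "x \<in> V" "\<forall>y\<in>V. f y = f x"
    using assms by blast
  then have "V \<subseteq> {x \<in> topspace X. P (f x)}"
    using x openin_subset by fastforce
  then show "\<exists>T. openin X T \<and> x \<in> T \<and> T \<subseteq> {x \<in> topspace X. P (f x)}"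
    using V by blast
qed

text \<open>The support of a locally constant function is closed, hence compact as soon as it sits
  in some compact \<open>K\<close>; this settles the closure condition in \<open>CR\<close>.\<close>

lemma CR_I:
  assumes zero: "\<And>x. x \<notin> topspace X \<Longrightarrow> f x = 0"
    and loc: "\<And>x. x \<in> topspace X \<Longrightarrow> \<exists>V. openin X V \<and> x \<in> V \<and> (\<forall>y\<in>V. f y = f x)"
    and K: "compactin X K" "{x \<in> topspace X. f x \<noteq> 0} \<subseteq> K"
  shows "f \<in> CR X"
proof -
  have "openin X {x \<in> topspace X. f x = 0}"
    by (rule locally_constant_openin[OF loc])
  then have "closedin X (topspace X - {x \<in> topspace X. f x = 0})"
    by (rule closedin_diff[OF closedin_topspace])
  also have "topspace X - {x \<in> topspace X. f x = 0} = {x \<in> topspace X. f x \<noteq> 0}"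
    by auto
  finally have cl: "closedin X {x \<in> topspace X. f x \<noteq> 0}" .
  have "compactin X {x \<in> topspace X. f x \<noteq> 0}"
    using closed_compactin[OF K cl] .
  then show ?thesis
    using zero loc closure_of_closedin[OF cl] by (simp add: CR_def)
qed

lemma
  assumes "f \<in> CR X"
  shows CR_outside: "x \<notin> topspace X \<Longrightarrow> f x = 0"
    and CR_openin: "openin X {x \<in> topspace X. P (f x)}"
    and CR_compactin: "compactin X {x. f x \<noteq> 0}"
proof -
  have z: "\<forall>x. x \<notin> topspace X \<longrightarrow> f x = 0"
    and l: "\<And>x. x \<in> topspace X \<Longrightarrow> \<exists>V. openin X V \<and> x \<in> V \<and> (\<forall>y\<in>V. f y = f x)"
    and c: "compactin X (X closure_of {x \<in> topspace X. f x \<noteq> 0})"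
    using assms by (auto simp: CR_def)
  show "x \<notin> topspace X \<Longrightarrow> f x = 0"
    using z by blast
  show "openin X {x \<in> topspace X. P (f x)}"
    by (rule locally_constant_openin[OF l])
  have "openin X {x \<in> topspace X. f x = 0}"
    by (rule locally_constant_openin[OF l])
  then have "closedin X (topspace X - {x \<in> topspace X. f x = 0})"
    by (rule closedin_diff[OF closedin_topspace])
  also have "topspace X - {x \<in> topspace X. f x = 0} = {x. f x \<noteq> 0}"
    using z by auto
  finally have "closedin X {x. f x \<noteq> 0}" .
  moreover have "{x \<in> topspace X. f x \<noteq> 0} = {x. f x \<noteq> 0}"
    using z by auto
  ultimately show "compactin X {x. f x \<noteq> 0}"
    using c closure_of_closedin by force
qed

lemma CR_zero: "(\<lambda>_. 0) \<in> CR X"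
  by (rule CR_I[where K = "{}"]) auto

text \<open>The condition \<open>F 0 0 = 0\<close> keeps the new support inside the union of the two
  old ones. Letting \<open>F\<close> ignore an argument covers scalar multiples as well as sums and
  products.\<close>

lemma CR_combine:
  fixes F :: "'r::comm_ring_1 \<Rightarrow> 'r \<Rightarrow> 'r"
  assumes f: "f \<in> CR X" and h: "h \<in> CR X" and F: "F 0 0 = 0"
  shows "(\<lambda>x. F (f x) (h x)) \<in> CR X"
proof (rule CR_I)
  show "F (f x) (h x) = 0" if "x \<notin> topspace X" for x
    using that f h F by (simp add: CR_outside)
  show "\<exists>V. openin X V \<and> x \<in> V \<and> (\<forall>y\<in>V. F (f y) (h y) = F (f x) (h x))" if "x \<in> topspace X" for x
    using that openin_Int[OF CR_openin[OF f, of "\<lambda>v. v = f x"] CR_openin[OF h, of "\<lambda>v. v = h x"]]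
    by (intro exI[of _ "{y \<in> topspace X. f y = f x} \<inter> {y \<in> topspace X. h y = h x}"]) auto
  show "compactin X ({x. f x \<noteq> 0} \<union> {x. h x \<noteq> 0})"
    using f h by (simp add: CR_compactin compactin_Un)
  show "{x \<in> topspace X. F (f x) (h x) \<noteq> 0} \<subseteq> {x. f x \<noteq> 0} \<union> {x. h x \<noteq> 0}"
    using F by auto
qed

lemma CR_add: "f \<in> CR X \<Longrightarrow> h \<in> CR X \<Longrightarrow> (\<lambda>x. f x + h x) \<in> CR X"
  by (rule CR_combine) auto

lemma CR_mult: "f \<in> CR X \<Longrightarrow> h \<in> CR X \<Longrightarrow> (\<lambda>x. f x * h x) \<in> CR X"
  by (rule CR_combine) auto

lemma CR_smul: "f \<in> CR X \<Longrightarrow> (\<lambda>x. k * f x) \<in> CR X"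
  using CR_combine[of f X f "\<lambda>a b. k * a"] by simp

lemma CR_uminus: "f \<in> CR X \<Longrightarrow> (\<lambda>x. - f x) \<in> CR X"
  using CR_smul[of f X "-1"] by simp

lemma CR_sum:
  assumes "\<And>i. i \<in> I \<Longrightarrow> f i \<in> CR X"
  shows "(\<lambda>x. \<Sum>i\<in>I. f i x) \<in> CR X"
  using assms by (induction I rule: infinite_finite_induct) (auto intro: CR_zero CR_add)

text \<open>A compact open subset of a Hausdorff space is clopen, so cutting off outside
  \<open>B\<close> preserves local constancy. Applied with \<open>p\<close> the range map, the
  domain map and the identity.\<close>

lemma CR_pullback:
  assumes B: "openin X B" "compactin X B" and X: "Hausdorff_space X"
    and p: "continuous_map X Y p" and f: "f \<in> CR Y"
  shows "(\<lambda>x. if x \<in> B then f (p x) else 0) \<in> CR X"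
proof (rule CR_I)
  have cl: "closedin X B"
    using compactin_imp_closedin[OF X B(2)] .
  show "(if x \<in> B then f (p x) else 0) = 0" if "x \<notin> topspace X" for x
    using that B openin_subset by fastforce
  show "\<exists>V. openin X V \<and> x \<in> V \<and>
      (\<forall>y\<in>V. (if y \<in> B then f (p y) else 0) = (if x \<in> B then f (p x) else 0))"
    if x: "x \<in> topspace X" for x
  proof (cases "x \<in> B")
    case True
    have "p x \<in> topspace Y"
      using continuous_map_image_subset_topspace[OF p] x by blast
    then show ?thesis
      using True openin_continuous_map_preimage_gen[OF p B(1) CR_openin[OF f, of "\<lambda>v. v = f (p x)"]]
      by (intro exI[of _ "{y \<in> B. p y \<in> {z \<in> topspace Y. f z = f (p x)}}"]) auto
  next
    case False
    then show ?thesis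
      using x cl by (intro exI[of _ "topspace X - B"]) auto
  qed
qed (use B in auto)

text \<open>Lets the coefficient algebra on \<open>U\<close>, its ideals and the Steinberg algebra
  of the reduction all be handled as functions on the one space \<open>gtop G\<close>. Extension by
  zero stays locally constant outside \<open>S\<close> because a compact support is closed.\<close>

lemma CR_subtopology:
  assumes X: "Hausdorff_space X" and S: "openin X S"
  shows "CR (subtopology X S) = {f \<in> CR X. \<forall>x. x \<notin> S \<longrightarrow> f x = 0}"
proof (intro set_eqI iffI)
  have top: "topspace (subtopology X S) = S"
    using openin_subset[OF S] by auto
  fix f :: "'a \<Rightarrow> 'b"
  {
    assume f: "f \<in> CR (subtopology X S)"
    have c: "compactin X {x. f x \<noteq> 0}"
      using CR_compactin[OF f] by (simp add: compactin_subtopology)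
    have z: "f x = 0" if "x \<notin> S" for x
      using CR_outside[OF f] that top by simp
    have "f \<in> CR X"
    proof (rule CR_I[OF _ _ c])
      show "f x = 0" if "x \<notin> topspace X" for x
        using that z openin_subset[OF S] by blast
      show "\<exists>V. openin X V \<and> x \<in> V \<and> (\<forall>y\<in>V. f y = f x)" if x: "x \<in> topspace X" for x
      proof (cases "x \<in> S")
        case True
        have "openin X {y \<in> S. f y = f x}"
          using openin_trans_full[OF CR_openin[OF f, of "\<lambda>v. v = f x"] S] unfolding top .
        then show ?thesis
          using True by (intro exI[of _ "{y \<in> S. f y = f x}"]) simp
      next
        case False
        then show ?thesis
          using z x compactin_imp_closedin[OF X c]
          by (intro exI[of _ "topspace X - {x. f x \<noteq> 0}"]) auto
      qed
    qed auto
    then show "f \<in> {f \<in> CR X. \<forall>x. x \<notin> S \<longrightarrow> f x = 0}"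
      using z by simp
  next
    assume "f \<in> {f \<in> CR X. \<forall>x. x \<notin> S \<longrightarrow> f x = 0}"
    then have f: "f \<in> CR X" and z: "\<And>x. x \<notin> S \<Longrightarrow> f x = 0"
      by auto
    show "f \<in> CR (subtopology X S)"
    proof (rule CR_I)
      show "compactin (subtopology X S) {x. f x \<noteq> 0}"
        using CR_compactin[OF f] z by (auto simp: compactin_subtopology)
      show "\<exists>V. openin (subtopology X S) V \<and> x \<in> V \<and> (\<forall>y\<in>V. f y = f x)"
        if "x \<in> topspace (subtopology X S)" for x
        using that openin_subtopology_Int[OF CR_openin[OF f, of "\<lambda>v. v = f x"], of S]
        by (intro exI[of _ "{y \<in> topspace X. f y = f x} \<inter> S"]) auto
    qed (use z top in auto)
  }
qed

section \<open>Compact open bisections\<close>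

lemma setmultI: "b \<in> B \<Longrightarrow> x \<in> C \<Longrightarrow> dm G b = rg G x \<Longrightarrow> mul G b x \<in> setmult G B C"
  by (auto simp: setmult_def)

lemma setmultE:
  assumes "x \<in> setmult G B C"
  obtains b y where "x = mul G b y" "b \<in> B" "y \<in> C" "dm G b = rg G y"
  using assms by (auto simp: setmult_def)

section \<open>Groupoid identities and continuity of the structure maps\<close>

locale graded_ample_groupoid =
  fixes G :: "('a, 'b) gpd_scheme" and c :: "'a \<Rightarrow> 'g::group_add" and U :: "'a set"
  assumes topological_groupoid: "topological_groupoid G"
    and ample: "ample G"
    and Hausdorff: "Hausdorff_space (gtop G)"
    and grading: "grading G c"
    and U_subset: "U \<subseteq> units G"
    and U_openin: "openin (subtopology (gtop G) (units G)) U"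
    and invariant: "invariant G U"
begin

abbreviation "d \<equiv> dm G"
abbreviation "r \<equiv> rg G"
abbreviation "X \<equiv> gtop G"
abbreviation "H \<equiv> reduce G U"
abbreviation mult (infixl "\<cdot>" 70) where "x \<cdot> y \<equiv> mul G x y"
abbreviation cob where "cob \<equiv> compact_open_bisection G"

lemma groupoid: "groupoid G"
  using topological_groupoid by (simp add: topological_groupoid_def)

lemma
  assumes "x \<in> arrows G"
  shows d_in: "d x \<in> arrows G" and r_in: "r x \<in> arrows G" and iv_in: "iv G x \<in> arrows G"
    and dd: "d (d x) = d x" and dr: "d (r x) = r x"
    and r_mult_self: "r x \<cdot> x = x"
    and d_iv: "d (iv G x) = r x" and r_iv: "r (iv G x) = d x"
    and iv_mult: "iv G x \<cdot> x = d x" and mult_iv: "x \<cdot> iv G x = r x"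
  using groupoid assms unfolding groupoid_def by blast+

lemma
  assumes "x \<in> arrows G" "y \<in> arrows G" "d x = r y"
  shows mult_in: "x \<cdot> y \<in> arrows G" and d_mult: "d (x \<cdot> y) = d y" and r_mult: "r (x \<cdot> y) = r x"
  using groupoid assms unfolding groupoid_def by blast+

lemma mult_assoc:
  assumes "x \<in> arrows G" "y \<in> arrows G" "z \<in> arrows G" "d x = r y" "d y = r z"
  shows "(x \<cdot> y) \<cdot> z = x \<cdot> (y \<cdot> z)"
  using groupoid assms unfolding groupoid_def by blast

lemma iv_mult_cancel:
  assumes "x \<in> arrows G" "y \<in> arrows G" "d x = r y"
  shows "iv G x \<cdot> (x \<cdot> y) = y"
  using assms mult_assoc[of "iv G x" x y] by (simp add: iv_in d_iv iv_mult r_mult_self)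

lemma mult_iv_cancel:
  assumes "x \<in> arrows G" "y \<in> arrows G" "r x = r y"
  shows "x \<cdot> (iv G x \<cdot> y) = y"
  using assms mult_assoc[of x "iv G x" y] by (simp add: iv_in d_iv r_iv mult_iv r_mult_self)

lemma
  assumes "x \<in> arrows G"
  shows d_units: "d x \<in> units G" and r_units: "r x \<in> units G"
  using assms dr[OF assms] r_in[OF assms] unfolding units_def by (auto intro: rev_image_eqI)

lemma units_arrows: "units G \<subseteq> arrows G"
  using d_in unfolding units_def by auto

lemma d_unit: "x \<in> units G \<Longrightarrow> d x = x"
  using dd unfolding units_def by auto

text \<open>Invariance gives one direction; applied to the inverse arrow it gives the other.\<close>

lemma U_iff: "x \<in> arrows G \<Longrightarrow> r x \<in> U \<longleftrightarrow> d x \<in> U"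
  using invariant[unfolded invariant_def, rule_format, of x]
    invariant[unfolded invariant_def, rule_format, of "iv G x"] by (auto simp: iv_in d_iv r_iv)

lemma continuous_iv: "continuous_map X X (iv G)"
  using topological_groupoid by (simp add: topological_groupoid_def)

lemma continuous_mult:
  assumes "continuous_map Y X p" "continuous_map Y X q" "\<And>y. y \<in> topspace Y \<Longrightarrow> d (p y) = r (q y)"
  shows "continuous_map Y X (\<lambda>y. p y \<cdot> q y)"
proof -
  have m: "continuous_map (subtopology (prod_topology X X) (composable_pairs G)) X (\<lambda>(a, b). a \<cdot> b)"
    using topological_groupoid by (simp add: topological_groupoid_def)
  have "continuous_map Y (subtopology (prod_topology X X) (composable_pairs G)) (\<lambda>y. (p y, q y))"
    using assms continuous_map_image_subset_topspace[OF assms(1)]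
      continuous_map_image_subset_topspace[OF assms(2)]
    by (auto simp: continuous_map_in_subtopology continuous_map_pairedI composable_pairs_def
        arrows_def)
  from continuous_map_compose[OF this m] show ?thesis
    by (simp add: o_def)
qed

text \<open>The axioms give continuity of inversion and multiplication; the domain map inherits it
  from d(x) = x^-1 x.\<close>

lemma continuous_d: "continuous_map X X d"
proof (rule continuous_map_eq)
  show "continuous_map X X (\<lambda>x. iv G x \<cdot> x)"
    by (rule continuous_mult) (auto simp: continuous_iv d_iv simp flip: arrows_def)
qed (simp add: iv_mult flip: arrows_def)

lemma continuous_r: "continuous_map X X r"
proof (rule continuous_map_eq)
  show "continuous_map X X (\<lambda>x. x \<cdot> iv G x)"
    by (rule continuous_mult) (auto simp: continuous_iv r_iv simp flip: arrows_def)
qed (simp add: mult_iv flip: arrows_def)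

section \<open>Open units; subsets and products of compact open bisections\<close>

lemma
  assumes "cob B"
  shows cob_openin: "openin X B" and cob_compactin: "compactin X B" and cob_arrows: "B \<subseteq> arrows G"
    and cob_inj_d: "inj_on d B" and cob_inj_r: "inj_on r B"
proof -
  show o: "openin X B" "compactin X B"
    using assms by (auto simp: compact_open_bisection_def bisection_def)
  then have "topspace (subtopology X B) = B"
    using openin_subset by fastforce
  then show "inj_on d B" "inj_on r B"
    using assms homeomorphic_imp_injective_map unfolding compact_open_bisection_def bisection_def by fastforce+
  show "B \<subseteq> arrows G"
    using o openin_subset by (auto simp: arrows_def)
qed

lemma cob_closedin: "cob B \<Longrightarrow> closedin X B"
  by (simp add: Hausdorff cob_compactin compactin_imp_closedin)

lemma cob_subset_exists:
  assumes "openin X W" "x \<in> W"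
  obtains B where "cob B" "x \<in> B" "B \<subseteq> W"
  using ample assms unfolding ample_def by blast

text \<open>If b and d(b) both lie in a bisection, then d(d(b)) = d(b) forces d(b) = b. So a
  bisection B around a unit contains an open set of units around it, namely the b in B with d(b) in
  B.\<close>

lemma units_openin: "openin X (units G)"
proof (subst openin_subopen, clarify)
  fix u assume u: "u \<in> units G"
  then have "u \<in> topspace X"
    using units_arrows by (auto simp: arrows_def)
  then obtain B where B: "cob B" "u \<in> B"
    using cob_subset_exists[OF openin_topspace] by blast
  have "openin X {b \<in> B. d b \<in> B}"
    using openin_continuous_map_preimage_gen[OF continuous_d cob_openin[OF B(1)] cob_openin[OF B(1)]] .
  moreover have "{b \<in> B. d b \<in> B} \<subseteq> units G"
  proof clarify
    fix b assume b: "b \<in> B" "d b \<in> B"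
    then have "b \<in> arrows G"
      using cob_arrows[OF B(1)] by blast
    then have "d b = b"
      using cob_inj_d[OF B(1)] b dd by (meson inj_onD)
    then show "b \<in> units G"
      using \<open>b \<in> arrows G\<close> d_units by metis
  qed
  ultimately show "\<exists>T. openin X T \<and> u \<in> T \<and> T \<subseteq> units G"
    using B(2) d_unit[OF u] by (intro exI[of _ "{b \<in> B. d b \<in> B}"]) auto
qed

lemma units_sub_openin: "openin (subtopology X (units G)) S \<longleftrightarrow> openin X S \<and> S \<subseteq> units G"
  using openin_open_subtopology[OF units_openin] by simp

lemma openin_U: "openin X U"
  using U_openin by (simp add: units_sub_openin)

text \<open>Continuous injections from compact to Hausdorff spaces are embeddings.\<close>

lemma cob_I:
  assumes "openin X B" "compactin X B" "inj_on d B" "inj_on r B" "openin X (d ` B)" "openin X (r ` B)"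
  shows "cob B"
proof -
  have B: "B \<subseteq> arrows G"
    using openin_subset[OF assms(1)] by (simp add: arrows_def)
  have emb: "homeomorphic_map (subtopology X B) (subtopology X (p ` B)) p"
    if p: "continuous_map X X p" "inj_on p B" for p
  proof (rule continuous_imp_homeomorphic_map)
    show "compact_space (subtopology X B)"
      using assms(2) by (simp add: compactin_subspace)
    show "Hausdorff_space (subtopology X (p ` B))"
      by (simp add: Hausdorff Hausdorff_space_subtopology)
    show "continuous_map (subtopology X B) (subtopology X (p ` B)) p"
      using continuous_map_from_subtopology[OF p(1)] by (auto simp: continuous_map_in_subtopology)
    have "p ` topspace X \<subseteq> topspace X"
      by (rule continuous_map_image_subset_topspace[OF p(1)])
    then show "p ` topspace (subtopology X B) = topspace (subtopology X (p ` B))"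
      using B by (auto simp: arrows_def)
    show "inj_on p (topspace (subtopology X B))"
      using p(2) by (rule inj_on_subset) auto
  qed
  show ?thesis
    unfolding compact_open_bisection_def bisection_def
    using assms emb[OF continuous_d] emb[OF continuous_r] B d_units r_units
    by (auto simp: units_sub_openin)
qed

lemma bisection_image_openin:
  assumes B: "cob B" and V: "openin X V" "V \<subseteq> B"
  shows "openin X (d ` V)" "openin X (r ` V)"
proof -
  have V': "openin (subtopology X B) V" "V \<subseteq> topspace (subtopology X B)"
    using V openin_open_subtopology[OF cob_openin[OF B]] openin_subset by fastforce+
  have h: "homeomorphic_map (subtopology X B) (subtopology X (d ` B)) d"
    "homeomorphic_map (subtopology X B) (subtopology X (r ` B)) r"
    and o: "openin X (d ` B)" "openin X (r ` B)"
    using B by (auto simp: compact_open_bisection_def bisection_def units_sub_openin)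
  show "openin X (d ` V)"
    using homeomorphic_map_openness[OF h(1) V'(2)] V'(1) openin_trans_full[OF _ o(1)] by blast
  show "openin X (r ` V)"
    using homeomorphic_map_openness[OF h(2) V'(2)] V'(1) openin_trans_full[OF _ o(2)] by blast
qed

lemma cob_subset:
  assumes "cob B" "V \<subseteq> B" "openin X V" "closedin X V"
  shows "cob V"
proof (rule cob_I[OF assms(3)])
  show "compactin X V"
    using closed_compactin[OF cob_compactin[OF assms(1)] assms(2,4)] .
  show "inj_on d V" "inj_on r V"
    using assms(1,2) cob_inj_d cob_inj_r inj_on_subset by blast+
qed (use bisection_image_openin[OF assms(1,3,2)] in auto)

text \<open>Since B is a bisection, d and r have continuous inverses \<open>p\<close> and
  \<open>q\<close> on it. They exhibit the product set both as a preimage, which makes it open, and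
  as an image of a compact set, which makes it compact.\<close>

lemma setmult_cob:
  assumes B: "cob B" and C: "cob C"
  shows "cob (setmult G B C)"
proof -
  note BA = subsetD[OF cob_arrows[OF B]] and CA = subsetD[OF cob_arrows[OF C]]
  have hd: "homeomorphic_map (subtopology X B) (subtopology X (d ` B)) d"
    and hr: "homeomorphic_map (subtopology X B) (subtopology X (r ` B)) r"
    using B by (auto simp: compact_open_bisection_def bisection_def)
  have topB: "topspace (subtopology X B) = B"
    using BA by (auto simp: arrows_def)
  obtain p where "homeomorphic_maps (subtopology X B) (subtopology X (d ` B)) d p"
    using hd homeomorphic_map_maps by blast
  then have p: "continuous_map (subtopology X (d ` B)) (subtopology X B) p" "\<And>b. b \<in> B \<Longrightarrow> p (d b) = b"
    using topB by (auto simp: homeomorphic_maps_def)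
  obtain q where "homeomorphic_maps (subtopology X B) (subtopology X (r ` B)) r q"
    using hr homeomorphic_map_maps by blast
  then have q: "continuous_map (subtopology X (r ` B)) (subtopology X B) q" "\<And>b. b \<in> B \<Longrightarrow> q (r b) = b"
    using topB by (auto simp: homeomorphic_maps_def)
  have oB: "openin X (d ` B)" "openin X (r ` B)"
    using bisection_image_openin[OF B cob_openin[OF B]] by auto
  have oC: "openin X (d ` C)" "openin X (r ` C)"
    using bisection_image_openin[OF C cob_openin[OF C]] by auto
  \<comment> \<open>The elements of C and of B that occur as factors of a product; the product set
    has the domains of the former and the ranges of the latter.\<close>
  let ?C = "{x \<in> C. r x \<in> d ` B}" and ?B = "{x \<in> B. d x \<in> r ` C}"
  have r_BC: "r ` setmult G B C = r ` ?B"
  proof (intro subset_antisym image_subsetI)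
    fix x assume "x \<in> setmult G B C"
    then show "r x \<in> r ` ?B"
    proof (rule setmultE)
      fix b y assume "x = b \<cdot> y" "b \<in> B" "y \<in> C" "d b = r y"
      then show ?thesis
        using BA CA r_mult[of b y] by (intro image_eqI[of _ _ b]) auto
    qed
  next
    fix b assume "b \<in> ?B"
    then obtain y where "b \<in> B" "y \<in> C" "d b = r y"
      by auto
    then have "r b = r (b \<cdot> y)" "b \<cdot> y \<in> setmult G B C"
      using BA CA r_mult[of b y] by (auto intro: setmultI)
    then show "r b \<in> r ` setmult G B C"
      by blast
  qed
  have d_BC: "d ` setmult G B C = d ` ?C"
  proof (intro subset_antisym image_subsetI)
    fix x assume "x \<in> setmult G B C"
    then show "d x \<in> d ` ?C"
    proof (rule setmultE)
      fix b y assume "x = b \<cdot> y" "b \<in> B" "y \<in> C" "d b = r y"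
      then show ?thesis
        using BA CA d_mult[of b y] by (intro image_eqI[of _ _ y]) (auto simp: rev_image_eqI)
    qed
  next
    fix y assume "y \<in> ?C"
    then obtain b where "b \<in> B" "y \<in> C" "d b = r y"
      by auto
    then have "d y = d (b \<cdot> y)" "b \<cdot> y \<in> setmult G B C"
      using BA CA d_mult[of b y] by (auto intro: setmultI)
    then show "d y \<in> d ` setmult G B C"
      by blast
  qed
  have open_C: "openin X ?C" and open_B: "openin X ?B"
    using openin_continuous_map_preimage_gen[OF continuous_r cob_openin[OF C] oB(1)]
      openin_continuous_map_preimage_gen[OF continuous_d cob_openin[OF B] oC(2)] .
  have cl: "closedin X (d ` B)"
    using image_compactin[OF cob_compactin[OF B] continuous_d] compactin_imp_closedin[OF Hausdorff] by blast
  have comp_C: "compactin X ?C"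
    using closed_compactin[OF cob_compactin[OF C] _
        closedin_continuous_map_preimage_gen[OF continuous_r cob_closedin[OF C] cl]] by blast

  \<comment> \<open>An arrow x with range in r(B) has only one candidate left factor,
    \<open>q (r x)\<close>, so x is in the product set exactly when the remaining factor lies in
    C.\<close>
  let ?W = "{x \<in> topspace X. r x \<in> r ` B}"
  have oW: "openin X ?W"
    using openin_continuous_map_preimage[OF continuous_r oB(2)] .
  have topW: "topspace (subtopology X ?W) = ?W"
    by auto
  have "continuous_map (subtopology X ?W) (subtopology X (r ` B)) r"
    by (simp add: continuous_map_in_subtopology continuous_map_from_subtopology continuous_r)
  from continuous_map_compose[OF this q(1)]
  have qr: "continuous_map (subtopology X ?W) X (\<lambda>x. q (r x))"
    by (simp add: o_def continuous_map_in_subtopology)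
  have "continuous_map (subtopology X ?W) X (\<lambda>x. iv G (q (r x)) \<cdot> x)"
  proof (rule continuous_mult)
    show "continuous_map (subtopology X ?W) X (\<lambda>x. iv G (q (r x)))"
      using continuous_map_compose[OF qr continuous_iv] by (simp add: o_def)
    show "d (iv G (q (r x))) = r x" if "x \<in> topspace (subtopology X ?W)" for x
    proof -
      have "r x \<in> r ` B"
        using that by simp
      then obtain b where "b \<in> B" "r x = r b"
        by blast
      then show ?thesis
        using q(2)[of b] d_iv[of b] BA by auto
    qed
  qed simp
  from openin_continuous_map_preimage[OF this cob_openin[OF C]]
  have "openin X {x \<in> ?W. iv G (q (r x)) \<cdot> x \<in> C}"
    using openin_trans_full[OF _ oW] unfolding topW by blast
  also have "{x \<in> ?W. iv G (q (r x)) \<cdot> x \<in> C} = setmult G B C"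
  proof (intro set_eqI iffI)
    fix x assume "x \<in> {x \<in> ?W. iv G (q (r x)) \<cdot> x \<in> C}"
    then obtain b where b: "b \<in> B" "r x = r b" "x \<in> arrows G" "iv G b \<cdot> x \<in> C"
      using q(2) by (auto simp: arrows_def)
    then have "b \<cdot> (iv G b \<cdot> x) = x" "r (iv G b \<cdot> x) = d b"
      using BA mult_iv_cancel[of b x] r_mult[of "iv G b" x] iv_in[of b] d_iv[of b] r_iv[of b] by auto
    then show "x \<in> setmult G B C"
      using setmultI[OF b(1,4), of G] by simp
  next
    fix x assume "x \<in> setmult G B C"
    then obtain b y where "x = b \<cdot> y" "b \<in> B" "y \<in> C" "d b = r y"
      by (auto simp: setmult_def)
    then show "x \<in> {x \<in> ?W. iv G (q (r x)) \<cdot> x \<in> C}"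
      using BA CA q(2)[of b] r_mult[of b y] iv_mult_cancel[of b y] mult_in[of b y]
      by (auto simp flip: arrows_def)
  qed
  finally have op: "openin X (setmult G B C)" .

  \<comment> \<open>Each y in \<open>?C\<close> has only one possible left factor,
    \<open>p (r y)\<close>, so the product set is a continuous image of the compact set
    \<open>?C\<close>.\<close>
  let ?V = "{x \<in> topspace X. r x \<in> d ` B}"
  have "continuous_map (subtopology X ?V) (subtopology X (d ` B)) r"
    by (simp add: continuous_map_in_subtopology continuous_map_from_subtopology continuous_r)
  from continuous_map_compose[OF this p(1)]
  have pr: "continuous_map (subtopology X ?V) X (\<lambda>x. p (r x))"
    by (simp add: o_def continuous_map_in_subtopology)
  have "continuous_map (subtopology X ?V) X (\<lambda>x. p (r x) \<cdot> x)"
  proof (rule continuous_mult[OF pr])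
    show "d (p (r x)) = r x" if "x \<in> topspace (subtopology X ?V)" for x
    proof -
      have "r x \<in> d ` B"
        using that by simp
      then obtain b where "b \<in> B" "r x = d b"
        by blast
      then show ?thesis
        using p(2)[of b] by simp
    qed
  qed (simp add: continuous_map_from_subtopology)
  then have "compactin X ((\<lambda>x. p (r x) \<cdot> x) ` ?C)"
    using comp_C CA
    by (intro image_compactin[of "subtopology X ?V"]) (auto simp: compactin_subtopology arrows_def)
  also have "(\<lambda>x. p (r x) \<cdot> x) ` ?C = setmult G B C"
  proof (intro subset_antisym image_subsetI subsetI)
    fix y assume "y \<in> ?C"
    then obtain b where "b \<in> B" "y \<in> C" "d b = r y"
      by auto
    then show "p (r y) \<cdot> y \<in> setmult G B C"
      using p(2)[of b] setmultI[of b B y C G] by simp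
  next
    fix x assume "x \<in> setmult G B C"
    then show "x \<in> (\<lambda>x. p (r x) \<cdot> x) ` ?C"
    proof (rule setmultE)
      fix b y assume x: "x = b \<cdot> y" "b \<in> B" "y \<in> C" "d b = r y"
      then have "r y \<in> d ` B"
        by (metis imageI)
      then show ?thesis
        using x p(2)[of b] by (intro image_eqI[of _ _ y]) auto
    qed
  qed
  finally have comp: "compactin X (setmult G B C)" .

  have inj_d: "inj_on d (setmult G B C)"
  proof (rule inj_onI)
    fix x x' assume "x \<in> setmult G B C" "x' \<in> setmult G B C" "d x = d x'"
    then obtain b y b' y' where x: "x = b \<cdot> y" "b \<in> B" "y \<in> C" "d b = r y"
      and x': "x' = b' \<cdot> y'" "b' \<in> B" "y' \<in> C" "d b' = r y'" and eq: "d x = d x'"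
      by (auto elim!: setmultE)
    have "d y = d y'"
      using eq x x' BA CA d_mult[of b y] d_mult[of b' y'] by auto
    then have "y = y'"
      using x x' cob_inj_d[OF C] by (auto dest: inj_onD)
    moreover from this have "b = b'"
      using x x' inj_onD[OF cob_inj_d[OF B], of b b'] by auto
    ultimately show "x = x'"
      using x x' by simp
  qed
  have inj_r: "inj_on r (setmult G B C)"
  proof (rule inj_onI)
    fix x x' assume "x \<in> setmult G B C" "x' \<in> setmult G B C" "r x = r x'"
    then obtain b y b' y' where x: "x = b \<cdot> y" "b \<in> B" "y \<in> C" "d b = r y"
      and x': "x' = b' \<cdot> y'" "b' \<in> B" "y' \<in> C" "d b' = r y'" and eq: "r x = r x'"
      by (auto elim!: setmultE)
    have "r b = r b'"
      using eq x x' BA CA r_mult[of b y] r_mult[of b' y'] by auto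
    then have "b = b'"
      using x x' cob_inj_r[OF B] by (auto dest: inj_onD)
    moreover from this have "y = y'"
      using x x' inj_onD[OF cob_inj_r[OF C], of y y'] by auto
    ultimately show "x = x'"
      using x x' by simp
  qed
  show ?thesis
    using bisection_image_openin(1)[OF C open_C] bisection_image_openin(2)[OF B open_B]
    by (intro cob_I op comp inj_d inj_r) (auto simp: r_BC d_BC)
qed

end

section \<open>Evaluation of formal sums\<close>

abbreviation skew_supp :: "('a set \<Rightarrow> 'a \<Rightarrow> 'r::comm_ring_1) \<Rightarrow> 'a set set" where
  "skew_supp x \<equiv> {s. x s \<noteq> (\<lambda>_. 0)}"

definition skew_eval :: "('a, 'b) gpd_scheme \<Rightarrow> ('a set \<Rightarrow> 'a \<Rightarrow> 'r::comm_ring_1) \<Rightarrow> 'a \<Rightarrow> 'r" where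
  "skew_eval G x \<gamma> = (\<Sum>s \<in> {s \<in> skew_supp x. \<gamma> \<in> s}. x s (rg G \<gamma>))"

text \<open>Transports a function on the bisection B to the unit space along the inverse of the
  range map on B. It supplies the coefficient whose term at B evaluates to f on B.\<close>

definition push_rg :: "('a, 'b) gpd_scheme \<Rightarrow> 'a set \<Rightarrow> ('a \<Rightarrow> 'r::comm_ring_1) \<Rightarrow> 'a \<Rightarrow> 'r" where
  "push_rg G B f z = (if z \<in> rg G ` B then f (inv_into B (rg G) z) else 0)"

text \<open>The coefficient in the product of the terms a at s and b at t; it depends on t only
  through b.\<close>

definition skew_term :: "('a, 'b) gpd_scheme \<Rightarrow> 'a set \<Rightarrow> 'a set \<Rightarrow> ('a \<Rightarrow> 'r::comm_ring_1) \<Rightarrow> ('a \<Rightarrow> 'r) \<Rightarrow> 'a \<Rightarrow> 'r" where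
  "skew_term G U s a b = piB G U s (\<lambda>w. piB G U (setinv G s) a w * b w)"

text \<open>A common finite index set lets formal sums with different supports be compared term by
  term.\<close>

lemma skew_eval_superset:
  assumes "finite S" "skew_supp x \<subseteq> S"
  shows "skew_eval G x \<gamma> = (\<Sum>s\<in>S. if \<gamma> \<in> s then x s (rg G \<gamma>) else 0)"
  unfolding skew_eval_def using assms by (intro sum.mono_neutral_cong_left) auto

lemma skew_mult_alt:
  "skew_mult G U x y u = (\<lambda>z. \<Sum>p \<in> {p \<in> skew_supp x \<times> skew_supp y. setmult G (fst p) (snd p) = u}.
     skew_term G U (fst p) (x (fst p)) (y (snd p)) z)"
  unfolding skew_mult_def skew_term_def by (intro ext sum.cong) auto

context graded_ample_groupoid
begin

section \<open>The reduction to U and the coefficient ideals, as functions on the whole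
  groupoid\<close>

definition "GU = {x \<in> arrows G. d x \<in> U}"

lemma openin_GU: "openin X GU"
  using openin_continuous_map_preimage[OF continuous_d openin_U] by (simp add: GU_def arrows_def)

lemma gtop_reduce: "gtop H = subtopology X GU"
  by (simp add: reduce_def GU_def)

lemma reduce_simps [simp]: "dm H = d" "rg H = r" "mul H = mul G" "iv H = iv G"
  by (simp_all add: reduce_def)

lemma arrows_reduce: "arrows H = GU"
  by (auto simp: arrows_def gtop_reduce) (auto simp: GU_def arrows_def)

lemma GU_iff: "x \<in> GU \<longleftrightarrow> x \<in> arrows G \<and> r x \<in> U"
  by (auto simp: GU_def U_iff)

lemma steinberg_iff: "f \<in> steinberg H \<longleftrightarrow> f \<in> CR X \<and> (\<forall>x. f x \<noteq> 0 \<longrightarrow> x \<in> GU)"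
  unfolding steinberg_def gtop_reduce CR_subtopology[OF Hausdorff openin_GU] by blast

lemma Aideal_iff: "f \<in> Aideal G U B \<longleftrightarrow> f \<in> CR X \<and> (\<forall>x. f x \<noteq> 0 \<longrightarrow> x \<in> r ` B \<inter> U)"
  unfolding Aideal_def CR_subtopology[OF Hausdorff openin_U] by blast

lemma Aideal_zero: "(\<lambda>_. 0) \<in> Aideal G U B"
  by (simp add: Aideal_iff CR_zero)

lemma Aideal_mono: "a \<in> Aideal G U s \<Longrightarrow> s \<subseteq> t \<Longrightarrow> a \<in> Aideal G U t"
  by (auto simp: Aideal_iff) blast

lemma cob_empty: "cob {}"
  by (rule cob_I) auto

lemma Gh_iff: "B \<in> Gh G c \<longleftrightarrow> cob B \<and> (\<exists>g. \<forall>b\<in>B. c b = g)"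
  using cob_empty by (auto simp: Gh_def)

lemma Gh_cob: "B \<in> Gh G c \<Longrightarrow> cob B"
  by (simp add: Gh_iff)

lemma Gh_arrows: "B \<in> Gh G c \<Longrightarrow> b \<in> B \<Longrightarrow> b \<in> arrows G"
  using cob_arrows Gh_cob by blast

lemma Gh_inj_r: "B \<in> Gh G c \<Longrightarrow> b \<in> B \<Longrightarrow> b' \<in> B \<Longrightarrow> r b = r b' \<Longrightarrow> b = b'"
  using cob_inj_r[OF Gh_cob] by (meson inj_onD)

lemma Gh_inj_d: "B \<in> Gh G c \<Longrightarrow> b \<in> B \<Longrightarrow> b' \<in> B \<Longrightarrow> d b = d b' \<Longrightarrow> b = b'"
  using cob_inj_d[OF Gh_cob] by (meson inj_onD)

lemma Gh_subset: "B \<in> Gh G c \<Longrightarrow> V \<subseteq> B \<Longrightarrow> openin X V \<Longrightarrow> closedin X V \<Longrightarrow> V \<in> Gh G c"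
  using cob_subset by (fastforce simp: Gh_iff)

lemma setmult_Gh:
  assumes "B \<in> Gh G c" "C \<in> Gh G c"
  shows "setmult G B C \<in> Gh G c"
proof -
  obtain g h where g: "\<forall>b\<in>B. c b = g" and h: "\<forall>b\<in>C. c b = h"
    using assms by (auto simp: Gh_iff)
  have c_mult: "c (a \<cdot> b) = c a + c b" if "a \<in> arrows G" "b \<in> arrows G" "d a = r b" for a b
    using grading that unfolding grading_def by blast
  have "c x = g + h" if "x \<in> setmult G B C" for x
    using that
  proof (rule setmultE)
    fix b y assume "x = b \<cdot> y" "b \<in> B" "y \<in> C" "d b = r y"
    then show ?thesis
      using c_mult[of b y] Gh_arrows assms g h by simp
  qed
  then show ?thesis
    using setmult_cob assms by (auto simp: Gh_iff)
qed

lemma push_rg_apply: "B \<in> Gh G c \<Longrightarrow> b \<in> B \<Longrightarrow> push_rg G B f (r b) = f b"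
  using cob_inj_r[OF Gh_cob] by (simp add: push_rg_def)

lemma push_rg_outside: "z \<notin> r ` B \<Longrightarrow> push_rg G B f z = 0"
  by (simp add: push_rg_def)

text \<open>The range map is open on a bisection, so a level set of f inside B goes to an open set.
  Elsewhere the function vanishes on the complement of r(B), which is open because r(B) is
  compact.\<close>

lemma push_rg_CR:
  assumes B: "B \<in> Gh G c" and f: "f \<in> CR X"
  shows "push_rg G B f \<in> CR X"
proof (rule CR_I)
  have comp: "compactin X (r ` B)"
    using image_compactin[OF cob_compactin[OF Gh_cob[OF B]] continuous_r] .
  then show "compactin X (r ` B)" .
  show "{x \<in> topspace X. push_rg G B f x \<noteq> 0} \<subseteq> r ` B"
    using push_rg_outside by blast
  show "push_rg G B f x = 0" if "x \<notin> topspace X" for x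
    using that compactin_subset_topspace[OF comp] push_rg_outside by blast
  show "\<exists>V. openin X V \<and> x \<in> V \<and> (\<forall>y\<in>V. push_rg G B f y = push_rg G B f x)"
    if x: "x \<in> topspace X" for x
  proof (cases "x \<in> r ` B")
    case True
    then obtain b where b: "b \<in> B" "x = r b"
      by blast
    let ?V = "{y \<in> topspace X. f y = f b} \<inter> B"
    have "b \<in> ?V"
      using b(1) Gh_arrows[OF B] by (simp add: arrows_def)
    moreover have "openin X (r ` ?V)"
      by (intro bisection_image_openin(2)[OF Gh_cob[OF B]] openin_Int cob_openin[OF Gh_cob[OF B]]
          CR_openin[OF f]) auto
    ultimately show ?thesis
      using b push_rg_apply[OF B, of _ f] by (intro exI[of _ "r ` ?V"]) auto
  next
    case False
    then show ?thesis
      using x push_rg_outside[of _ B f] compactin_imp_closedin[OF Hausdorff comp]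
      by (intro exI[of _ "topspace X - r ` B"]) auto
  qed
qed

lemma push_rg_Aideal:
  assumes B: "B \<in> Gh G c" and f: "f \<in> steinberg H"
  shows "push_rg G B f \<in> Aideal G U B"
  using f push_rg_CR[OF B, of f] push_rg_outside[of _ B f] push_rg_apply[OF B, of _ f]
  by (auto simp: Aideal_iff steinberg_iff GU_iff) (metis imageE)+

lemma Gh_pullback:
  assumes "B \<in> Gh G c" "a \<in> CR X"
  shows "(\<lambda>x. if x \<in> B then a (r x) else 0) \<in> CR X" "(\<lambda>x. if x \<in> B then a (d x) else 0) \<in> CR X"
  using CR_pullback[OF cob_openin cob_compactin Hausdorff] assms continuous_r continuous_d Gh_cob
  by blast+

text \<open>The action of s carries values from d(\<beta>) to r(\<beta>) and the action of its
  inverse carries them back, so a is read at r(\<beta>) and b at d(\<beta>).\<close>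

lemma skew_term_apply:
  assumes s: "s \<in> Gh G c" and b: "\<beta> \<in> s" and a: "a \<in> Aideal G U s'"
  shows "skew_term G U s a b (r \<beta>) = a (r \<beta>) * b (d \<beta>)"
proof (cases "r \<beta> \<in> U")
  case True
  have arr: "\<beta> \<in> arrows G"
    using Gh_arrows s b .
  have 1: "(THE b. b \<in> s \<and> r b = r \<beta>) = \<beta>"
    using Gh_inj_r[OF s] b by blast
  \<comment> \<open>The inner action belongs to the inverse bisection: its only arrow with range
    d(\<beta>) is the inverse of \<beta>, whose domain is r(\<beta>).\<close>
  have 2: "(THE b. b \<in> iv G ` s \<and> r b = d \<beta>) = iv G \<beta>"
  proof (rule the_equality)
    fix b' assume b': "b' \<in> iv G ` s \<and> r b' = d \<beta>"
    then obtain \<alpha> where \<alpha>: "\<alpha> \<in> s" "b' = iv G \<alpha>"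
      by blast
    then have "d \<alpha> = d \<beta>"
      using b' r_iv Gh_arrows[OF s] by auto
    then show "b' = iv G \<beta>"
      using Gh_inj_d[OF s] \<alpha> b by blast
  qed (use b arr r_iv in auto)
  have "d \<beta> \<in> r ` (iv G ` s)"
    using b r_iv[OF arr] by force
  then show ?thesis
    using True b by (simp add: skew_term_def piB_def setinv_def 1 2 d_iv[OF arr] U_iff[OF arr])
next
  case False
  have "a (r \<beta>) = 0"
    using False a unfolding Aideal_iff by blast
  with False show ?thesis
    by (simp add: skew_term_def piB_def)
qed

lemma skew_term_outside: "z \<notin> r ` s \<Longrightarrow> skew_term G U s a b z = 0"
  by (simp add: skew_term_def piB_def)

lemma skew_term_Aideal:
  assumes s: "s \<in> Gh G c" and t: "t \<in> Gh G c" and a: "a \<in> Aideal G U s" and b: "b \<in> Aideal G U t"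
  shows "skew_term G U s a b \<in> Aideal G U (setmult G s t)"
proof -
  \<comment> \<open>On s the term is a product of two functions, one pulled back along r and the
    other along d, so \<open>push_rg_CR\<close> applies.\<close>
  let ?f = "\<lambda>\<beta>. (if \<beta> \<in> s then a (r \<beta>) else 0) * (if \<beta> \<in> s then b (d \<beta>) else 0)"
  have "skew_term G U s a b z = push_rg G s ?f z" for z
    by (cases "z \<in> r ` s") (auto simp: skew_term_apply[OF s _ a] push_rg_apply[OF s]
        push_rg_outside skew_term_outside)
  then have "skew_term G U s a b = push_rg G s ?f"
    by blast
  moreover have "?f \<in> CR X"
    using Gh_pullback[OF s] a b by (intro CR_mult) (auto simp: Aideal_iff)
  ultimately have "skew_term G U s a b \<in> CR X"
    using push_rg_CR[OF s] by simp
  moreover have "z \<in> r ` setmult G s t \<inter> U" if nz: "skew_term G U s a b z \<noteq> 0" for z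
  proof -
    obtain \<beta> where \<beta>: "\<beta> \<in> s" "z = r \<beta>"
      using nz skew_term_outside by blast
    then have "a (r \<beta>) \<noteq> 0" "b (d \<beta>) \<noteq> 0"
      using nz skew_term_apply[OF s _ a] by auto
    then obtain \<tau> where \<tau>: "\<tau> \<in> t" "d \<beta> = r \<tau>" and U: "z \<in> U"
      using a b \<beta> by (auto simp: Aideal_iff)
    have "\<beta> \<cdot> \<tau> \<in> setmult G s t" "r (\<beta> \<cdot> \<tau>) = z"
      using \<beta> \<tau> r_mult[of \<beta> \<tau>] Gh_arrows s t by (auto intro: setmultI)
    then show ?thesis
      using U by blast
  qed
  ultimately show ?thesis
    by (simp add: Aideal_iff)
qed

section \<open>Formal sums and their operations\<close>

lemma skewL_iff:
  "x \<in> skewL G c U \<longleftrightarrow> finite (skew_supp x) \<and> (\<forall>s\<in>skew_supp x. s \<in> Gh G c \<and> x s \<in> Aideal G U s)"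
proof -
  have "x s \<in> Aideal G U s" if "x s = (\<lambda>_. 0)" for s
    unfolding that by (rule Aideal_zero)
  then show ?thesis
    unfolding skewL_def mem_Collect_eq by blast
qed

lemma skewL_Aideal: "x \<in> skewL G c U \<Longrightarrow> x s \<in> Aideal G U s"
  using Aideal_zero by (cases "x s = (\<lambda>_. 0)") (auto simp: skewL_iff)

lemma skewL_combine:
  fixes F :: "'r::comm_ring_1 \<Rightarrow> 'r \<Rightarrow> 'r"
  assumes x: "x \<in> skewL G c U" and y: "y \<in> skewL G c U" and F: "F 0 0 = 0"
  shows "(\<lambda>s z. F (x s z) (y s z)) \<in> skewL G c U"
  unfolding skewL_iff
proof (intro conjI ballI)
  have sub: "skew_supp (\<lambda>s z. F (x s z) (y s z)) \<subseteq> skew_supp x \<union> skew_supp y"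
    using F by auto
  then show "finite (skew_supp (\<lambda>s z. F (x s z) (y s z)))"
    using x y by (intro finite_subset[OF sub]) (simp_all add: skewL_iff)
  fix s assume "s \<in> skew_supp (\<lambda>s z. F (x s z) (y s z))"
  then show "s \<in> Gh G c"
    using sub x y by (auto simp: skewL_iff)
  have "x s \<in> Aideal G U s" "y s \<in> Aideal G U s"
    using skewL_Aideal x y by auto
  then show "(\<lambda>z. F (x s z) (y s z)) \<in> Aideal G U s"
    using F CR_combine[of "x s" X "y s" F, OF _ _ F] by (auto simp: Aideal_iff) metis+
qed

lemma skewL_add: "x \<in> skewL G c U \<Longrightarrow> y \<in> skewL G c U \<Longrightarrow> skew_add x y \<in> skewL G c U"
  unfolding skew_add_def by (rule skewL_combine) auto

lemma skewL_neg: "x \<in> skewL G c U \<Longrightarrow> skew_neg x \<in> skewL G c U"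
  unfolding skew_neg_def using skewL_combine[of x x "\<lambda>a b. - a"] by simp

lemma skewL_smul: "x \<in> skewL G c U \<Longrightarrow> skew_smul k x \<in> skewL G c U"
  unfolding skew_smul_def using skewL_combine[of x x "\<lambda>a b. k * a"] by simp

lemma skew_supp_delta: "skew_supp (skew_delta s a) \<subseteq> {s}"
  by (auto simp: skew_delta_def)

lemma skewL_delta: "s \<in> Gh G c \<Longrightarrow> a \<in> Aideal G U s \<Longrightarrow> skew_delta s a \<in> skewL G c U"
  using finite_subset[OF skew_supp_delta[of s a]] by (auto simp: skewL_iff skew_delta_def)

lemma skewL_zero: "skew_zero \<in> skewL G c U"
  by (simp add: skewL_iff skew_zero_def)

lemma skew_supp_mult:
  "skew_supp (skew_mult G U x y) \<subseteq> (\<lambda>p. setmult G (fst p) (snd p)) ` (skew_supp x \<times> skew_supp y)"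
proof
  fix u assume u: "u \<in> skew_supp (skew_mult G U x y)"
  have "{p \<in> skew_supp x \<times> skew_supp y. setmult G (fst p) (snd p) = u} \<noteq> {}"
  proof
    assume "{p \<in> skew_supp x \<times> skew_supp y. setmult G (fst p) (snd p) = u} = {}"
    then have "skew_mult G U x y u = (\<lambda>_. 0)"
      unfolding skew_mult_alt by (simp only: sum.empty)
    with u show False
      by simp
  qed
  then show "u \<in> (\<lambda>p. setmult G (fst p) (snd p)) ` (skew_supp x \<times> skew_supp y)"
    by blast
qed

lemma Aideal_sum:
  assumes "\<And>i. i \<in> I \<Longrightarrow> f i \<in> Aideal G U B"
  shows "(\<lambda>z. \<Sum>i\<in>I. f i z) \<in> Aideal G U B"
  unfolding Aideal_iff
proof (intro conjI allI impI)
  show "(\<lambda>z. \<Sum>i\<in>I. f i z) \<in> CR X"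
    using assms by (intro CR_sum) (auto simp: Aideal_iff)
  fix z assume "(\<Sum>i\<in>I. f i z) \<noteq> 0"
  then obtain i where "i \<in> I" "f i z \<noteq> 0"
    by (meson sum.not_neutral_contains_not_neutral)
  then show "z \<in> r ` B \<inter> U"
    using assms by (auto simp: Aideal_iff)
qed

lemma skewL_mult:
  assumes x: "x \<in> skewL G c U" and y: "y \<in> skewL G c U"
  shows "skew_mult G U x y \<in> skewL G c U"
  unfolding skewL_iff
proof (intro conjI ballI)
  show "finite (skew_supp (skew_mult G U x y))"
    using x y by (intro finite_subset[OF skew_supp_mult]) (auto simp: skewL_iff)
  fix u assume "u \<in> skew_supp (skew_mult G U x y)"
  then show "u \<in> Gh G c"
  proof (rule imageE[OF subsetD[OF skew_supp_mult]])
    fix p assume "u = setmult G (fst p) (snd p)" "p \<in> skew_supp x \<times> skew_supp y"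
    then show ?thesis
      using x y setmult_Gh by (auto simp: skewL_iff)
  qed
  show "skew_mult G U x y u \<in> Aideal G U u"
    unfolding skew_mult_alt using x y by (intro Aideal_sum) (auto simp: skewL_iff intro: skew_term_Aideal)
qed

section \<open>Evaluation respects the algebra operations\<close>

lemma skew_eval_combine:
  fixes F :: "'r::comm_ring_1 \<Rightarrow> 'r \<Rightarrow> 'r"
  assumes x: "x \<in> skewL G c U" and y: "y \<in> skewL G c U" and F: "F 0 0 = 0"
    and add: "\<And>a b a' b'. F (a + a') (b + b') = F a b + F a' b'"
  shows "skew_eval G (\<lambda>s z. F (x s z) (y s z)) \<gamma> = F (skew_eval G x \<gamma>) (skew_eval G y \<gamma>)"
proof -
  let ?S = "skew_supp x \<union> skew_supp y"
  have fin: "finite ?S"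
    using x y by (auto simp: skewL_iff)
  have F_sum: "F (sum f I) (sum g I) = (\<Sum>i\<in>I. F (f i) (g i))" if "finite I" for I :: "'a set set" and f g
    using that by (induction I) (auto simp: F add)
  have "skew_eval G (\<lambda>s z. F (x s z) (y s z)) \<gamma> = (\<Sum>s\<in>?S. if \<gamma> \<in> s then F (x s (r \<gamma>)) (y s (r \<gamma>)) else 0)"
    by (rule skew_eval_superset[OF fin]) (use F in auto)
  also have "\<dots> = (\<Sum>s\<in>?S. F (if \<gamma> \<in> s then x s (r \<gamma>) else 0) (if \<gamma> \<in> s then y s (r \<gamma>) else 0))"
    by (intro sum.cong) (auto simp: F)
  also have "\<dots> = F (skew_eval G x \<gamma>) (skew_eval G y \<gamma>)"
    unfolding F_sum[OF fin, symmetric]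
    by (intro arg_cong2[of _ _ _ _ F] skew_eval_superset[OF fin, symmetric]) auto
  finally show ?thesis .
qed

lemma
  assumes "x \<in> skewL G c U"
  shows skew_eval_add: "y \<in> skewL G c U \<Longrightarrow> skew_eval G (skew_add x y) = (\<lambda>\<gamma>. skew_eval G x \<gamma> + skew_eval G y \<gamma>)"
    and skew_eval_neg: "skew_eval G (skew_neg x) = (\<lambda>\<gamma>. - skew_eval G x \<gamma>)"
    and skew_eval_smul: "skew_eval G (skew_smul k x) = (\<lambda>\<gamma>. k * skew_eval G x \<gamma>)"
  unfolding skew_add_def skew_neg_def skew_smul_def
  using skew_eval_combine[OF assms, of y "(+)"] skew_eval_combine[OF assms assms, of "\<lambda>a b. - a"]
    skew_eval_combine[OF assms assms, of "\<lambda>a b. k * a"]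
  by (auto simp: algebra_simps)

lemma skew_eval_delta: "skew_eval G (skew_delta s a) \<gamma> = (if \<gamma> \<in> s then a (r \<gamma>) else 0)"
  using skew_eval_superset[OF _ skew_supp_delta[of s a], of G \<gamma>] by (simp add: skew_delta_def)

lemma skew_eval_zero: "skew_eval G skew_zero \<gamma> = 0"
  by (simp add: skew_eval_def skew_zero_def)

lemma skew_eval_steinberg:
  assumes x: "x \<in> skewL G c U"
  shows "skew_eval G x \<in> steinberg H"
  unfolding steinberg_iff
proof (intro conjI allI impI)
  have fin: "finite (skew_supp x)"
    using x by (simp add: skewL_iff)
  note ev = skew_eval_superset[OF fin order_refl, of G]
  have "(\<lambda>\<gamma>. \<Sum>s\<in>skew_supp x. if \<gamma> \<in> s then x s (r \<gamma>) else 0) \<in> CR X"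
    using x by (intro CR_sum Gh_pullback(1)) (auto simp: skewL_iff Aideal_iff)
  moreover have "skew_eval G x = (\<lambda>\<gamma>. \<Sum>s\<in>skew_supp x. if \<gamma> \<in> s then x s (r \<gamma>) else 0)"
    using ev by blast
  ultimately show "skew_eval G x \<in> CR X"
    by simp
  fix \<gamma> assume "skew_eval G x \<gamma> \<noteq> 0"
  then obtain s where "s \<in> skew_supp x" "(if \<gamma> \<in> s then x s (r \<gamma>) else 0) \<noteq> 0"
    unfolding ev by (rule sum.not_neutral_contains_not_neutral)
  then have "s \<in> skew_supp x" "\<gamma> \<in> s" "x s (r \<gamma>) \<noteq> 0"
    by (auto split: if_splits)
  then show "\<gamma> \<in> GU"
    using x Gh_arrows by (auto simp: skewL_iff Aideal_iff GU_iff)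
qed

lemma skew_eval_mult:
  assumes x: "x \<in> skewL G c U" and y: "y \<in> skewL G c U"
  shows "skew_eval G (skew_mult G U x y) = conv H (skew_eval G x) (skew_eval G y)"
proof
  fix \<gamma>
  let ?S = "skew_supp x" and ?T = "skew_supp y" and ?f = "skew_eval G x" and ?g = "skew_eval G y"
  let ?m = "\<lambda>p. setmult G (fst p) (snd p)" and ?M = "skew_mult G U x y"
  let ?t = "\<lambda>p. skew_term G U (fst p) (x (fst p)) (y (snd p))"
  have finS: "finite ?S" and finT: "finite ?T"
    using x y by (auto simp: skewL_iff)
  have S: "s \<in> Gh G c" if "s \<in> ?S" for s
    using x that by (auto simp: skewL_iff)
  have T: "t \<in> Gh G c" if "t \<in> ?T" for t
    using y that by (auto simp: skewL_iff)
  show "skew_eval G ?M \<gamma> = conv H ?f ?g \<gamma>"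
  proof (cases "\<gamma> \<in> GU")
    case False
    then show ?thesis
      using skew_eval_steinberg[OF skewL_mult[OF x y]]
      by (auto simp: steinberg_iff conv_def arrows_reduce)
  next
    case True
    then have \<gamma>: "\<gamma> \<in> arrows G" "r \<gamma> \<in> U"
      by (auto simp: GU_iff)
    \<comment> \<open>Distinct pairs may have the same product set, so the sum over product sets is
      regrouped into a sum over pairs of factors.\<close>
    have "skew_eval G ?M \<gamma> = (\<Sum>u\<in>?m ` (?S \<times> ?T). if \<gamma> \<in> u then ?M u (r \<gamma>) else 0)"
      using finS finT by (intro skew_eval_superset skew_supp_mult) auto
    also have "\<dots> = (\<Sum>u\<in>?m ` (?S \<times> ?T). \<Sum>p\<in>{p \<in> ?S \<times> ?T. ?m p = u}. if \<gamma> \<in> ?m p then ?t p (r \<gamma>) else 0)"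
      unfolding skew_mult_alt by (intro sum.cong refl) (auto intro!: sum.neutral)
    also have "\<dots> = (\<Sum>p\<in>?S \<times> ?T. if \<gamma> \<in> ?m p then ?t p (r \<gamma>) else 0)"
      using finS finT by (intro sum.group) auto
    finally have lhs: "skew_eval G ?M \<gamma> = (\<Sum>p\<in>?S \<times> ?T. if \<gamma> \<in> ?m p then ?t p (r \<gamma>) else 0)" .

    \<comment> \<open>A finite index set unaffected by cancellation in \<open>?f\<close>: it
      contains every \<alpha> that counts in the convolution, and each bisection contributes at most
      one arrow with the range of \<gamma>.\<close>
    let ?A = "{\<alpha> \<in> GU. r \<alpha> = r \<gamma> \<and> (\<exists>s\<in>?S. \<alpha> \<in> s)}"
    have "?A \<subseteq> (\<Union>s\<in>?S. {\<alpha> \<in> s. r \<alpha> = r \<gamma>})"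
      by blast
    moreover have "finite {\<alpha> \<in> s. r \<alpha> = r \<gamma>}" if "s \<in> ?S" for s
    proof (cases "{\<alpha> \<in> s. r \<alpha> = r \<gamma>} = {}")
      case False
      then obtain \<alpha> where "\<alpha> \<in> s" "r \<alpha> = r \<gamma>"
        by blast
      then have "{\<alpha> \<in> s. r \<alpha> = r \<gamma>} \<subseteq> {\<alpha>}"
        using Gh_inj_r[OF S[OF that]] by auto
      then show ?thesis
        by (rule finite_subset) simp
    qed (simp only: finite.emptyI)
    ultimately have finA: "finite ?A"
      using finS by (meson finite_UN_I finite_subset)
    have f0: "\<alpha> \<in> ?A" if "?f \<alpha> \<noteq> 0" "\<alpha> \<in> GU" "r \<alpha> = r \<gamma>" for \<alpha>
    proof -
      have "{s \<in> ?S. \<alpha> \<in> s} \<noteq> {}"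
        using that(1) unfolding skew_eval_def by (metis (no_types, lifting) sum.empty)
      then show ?thesis
        using that by blast
    qed
    \<comment> \<open>The share of the pair (s, t) in the summand of the convolution at
      \<alpha>.\<close>
    define v where "v s t \<alpha> = (if \<alpha> \<in> s then x s (r \<alpha>) else 0)
        * (if iv G \<alpha> \<cdot> \<gamma> \<in> t then y t (r (iv G \<alpha> \<cdot> \<gamma>)) else 0)" for s t \<alpha>
    have "conv H ?f ?g \<gamma> = (\<Sum>\<alpha>\<in>?A. ?f \<alpha> * ?g (iv G \<alpha> \<cdot> \<gamma>))"
      unfolding conv_def using True f0 finA
      by (auto simp: arrows_reduce intro!: sum.mono_neutral_left)
    also have "\<dots> = (\<Sum>\<alpha>\<in>?A. \<Sum>s\<in>?S. \<Sum>t\<in>?T. v s t \<alpha>)"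
      unfolding v_def skew_eval_superset[OF finS order_refl] skew_eval_superset[OF finT order_refl]
      by (simp only: sum_product)
    also have "\<dots> = (\<Sum>s\<in>?S. \<Sum>\<alpha>\<in>?A. \<Sum>t\<in>?T. v s t \<alpha>)"
      by (rule sum.swap)
    also have "\<dots> = (\<Sum>s\<in>?S. \<Sum>t\<in>?T. \<Sum>\<alpha>\<in>?A. v s t \<alpha>)"
      by (intro sum.cong refl sum.swap)
    also have "\<dots> = (\<Sum>p\<in>?S \<times> ?T. \<Sum>\<alpha>\<in>?A. v (fst p) (snd p) \<alpha>)"
      by (simp only: case_prod_unfold sum.cartesian_product[where g = "\<lambda>s t. \<Sum>\<alpha>\<in>?A. v s t \<alpha>"])
    also have "\<dots> = (\<Sum>p\<in>?S \<times> ?T. if \<gamma> \<in> ?m p then ?t p (r \<gamma>) else 0)"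
    proof (intro sum.cong refl)
      fix p assume "p \<in> ?S \<times> ?T"
      then obtain s t where p: "p = (s, t)" "s \<in> ?S" "t \<in> ?T"
        by blast
      note sG = S[OF p(2)] and tG = T[OF p(3)]
      \<comment> \<open>For a fixed pair, only the left factor of a factorisation of \<gamma> can
        contribute, and injectivity of r on s leaves at most one such factor.\<close>
      show "(\<Sum>\<alpha>\<in>?A. v (fst p) (snd p) \<alpha>) = (if \<gamma> \<in> ?m p then ?t p (r \<gamma>) else 0)"
      proof (cases "\<gamma> \<in> setmult G s t")
        case True
        then obtain \<beta> \<tau> where bt: "\<gamma> = \<beta> \<cdot> \<tau>" "\<beta> \<in> s" "\<tau> \<in> t" "d \<beta> = r \<tau>"
          by (rule setmultE)
        have arr: "\<beta> \<in> arrows G" "\<tau> \<in> arrows G"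
          using bt Gh_arrows sG tG by auto
        have rb: "r \<beta> = r \<gamma>" and tau: "iv G \<beta> \<cdot> \<gamma> = \<tau>"
          using bt arr by (auto simp: r_mult iv_mult_cancel)
        have "\<beta> \<in> ?A"
          using rb \<gamma> arr bt p by (auto simp: GU_iff)
        moreover have "v s t \<alpha> = 0" if "\<alpha> \<in> ?A - {\<beta>}" for \<alpha>
          using that Gh_inj_r[OF sG _ bt(2)] rb by (auto simp: v_def)
        ultimately have "(\<Sum>\<alpha>\<in>?A. v s t \<alpha>) = v s t \<beta>"
          using finA sum.mono_neutral_right[of ?A "{\<beta>}" "v s t"] by simp
        also have "\<dots> = x s (r \<beta>) * y t (d \<beta>)"
          unfolding v_def tau using bt(2-4) by simp
        also have "\<dots> = skew_term G U s (x s) (y t) (r \<gamma>)"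
          using skew_term_apply[OF sG bt(2) skewL_Aideal[OF x]] rb by simp
        finally show ?thesis
          using True p by simp
      next
        case False
        have "v s t \<alpha> = 0" if \<alpha>: "\<alpha> \<in> ?A" for \<alpha>
        proof (rule ccontr)
          assume "v s t \<alpha> \<noteq> 0"
          then have st: "\<alpha> \<in> s" "iv G \<alpha> \<cdot> \<gamma> \<in> t"
            by (auto simp: v_def split: if_splits)
          then have "\<alpha> \<in> arrows G"
            using Gh_arrows[OF sG] by blast
          then have "\<gamma> = \<alpha> \<cdot> (iv G \<alpha> \<cdot> \<gamma>)" "d \<alpha> = r (iv G \<alpha> \<cdot> \<gamma>)"
            using \<alpha> \<gamma> by (auto simp: mult_iv_cancel r_mult iv_in d_iv r_iv)
          then show False
            using False setmultI[OF st, of G] by simp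
        qed
        then show ?thesis
          using False p by simp
      qed
    qed
    finally show ?thesis
      using lhs by simp
  qed
qed

section \<open>The kernel and the image of evaluation\<close>

text \<open>For a generator, a vanishes off r(s), and r is injective on the larger set t. So an
  arrow of t at whose range a is nonzero already lies in s, and the two terms evaluate alike. The
  closure rules follow from linearity and \<open>skew_eval_mult\<close>.\<close>

lemma skewN_kernel:
  assumes "x \<in> skewN G c U"
  shows "x \<in> skewL G c U \<and> skew_eval G x = (\<lambda>_. 0)"
  using assms
proof induction
  case (gen s t a)
  have at: "a \<in> Aideal G U t"
    using Aideal_mono gen by blast
  have L: "skew_delta s a \<in> skewL G c U" "skew_delta t a \<in> skewL G c U"
    using gen at by (auto intro: skewL_delta)
  have "a (r \<gamma>) = 0" if "\<gamma> \<in> t" "\<gamma> \<notin> s" for \<gamma>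
  proof (rule ccontr)
    assume "a (r \<gamma>) \<noteq> 0"
    then obtain \<gamma>' where "\<gamma>' \<in> s" "r \<gamma> = r \<gamma>'"
      using gen(4) by (auto simp: Aideal_iff)
    then show False
      using that gen(2,3) Gh_inj_r[of t \<gamma> \<gamma>'] by blast
  qed
  then have "skew_eval G (skew_add (skew_delta s a) (skew_neg (skew_delta t a))) \<gamma> = 0" for \<gamma>
    using L gen(3) skewL_neg[OF L(2)]
    by (auto simp: skew_eval_add skew_eval_neg skew_eval_delta)
  then show ?case
    using L by (auto intro: skewL_add skewL_neg)
next
  case zero
  then show ?case
    by (simp add: skewL_zero skew_eval_zero fun_eq_iff)
next
  case (left x l)
  then show ?case
    by (auto simp: skewL_mult skew_eval_mult conv_def)
next
  case (right x l)
  then show ?case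
    by (auto simp: skewL_mult skew_eval_mult conv_def)
qed (auto simp: skewL_add skewL_neg skewL_smul skew_eval_add skew_eval_neg skew_eval_smul)

lemma skewN_sum:
  assumes "\<And>i. i \<in> I \<Longrightarrow> F i \<in> skewN G c U"
  shows "(\<lambda>s z. \<Sum>i\<in>I. F i s z) \<in> skewN G c U"
  using assms
proof (induction I rule: infinite_finite_induct)
  case (insert i I)
  then show ?case
    using skewN.add[of "F i" G c U "\<lambda>s z. \<Sum>i\<in>I. F i s z"] by (simp add: skew_add_def)
qed (use skewN.zero in \<open>auto simp: skew_zero_def\<close>)

text \<open>The members of the support of \<open>x\<close> cut the groupoid into compact open atoms \<open>P T\<close>, where
  \<open>P T\<close> consists of the arrows lying in precisely the members of \<open>T\<close>.  Modulo the ideal each summand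
  of \<open>x\<close> may be cut along the atoms and moved onto them, and the resulting coefficient at \<open>P T\<close> is read
  off from the values of \<open>skew_eval G x\<close> on \<open>P T\<close>.\<close>

lemma skew_eval_kernel:
  assumes x: "x \<in> skewL G c U" and ev: "skew_eval G x = (\<lambda>_. 0)"
  shows "x \<in> skewN G c U"
proof -
  let ?S = "skew_supp x"
  have fin: "finite ?S"
    using x by (simp add: skewL_iff)
  have S: "s \<in> Gh G c" if "s \<in> ?S" for s
    using x that by (auto simp: skewL_iff)
  define P where "P T = {\<gamma> \<in> topspace X. \<forall>s\<in>?S. \<gamma> \<in> s \<longleftrightarrow> s \<in> T}" for T
  \<comment> \<open>For s in T and T inside the support this is the restriction of
    \<open>x s\<close> to r(P T). Writing it with \<open>push_rg\<close> lets
    \<open>push_rg_Aideal\<close> place it in the ideal of the atom.\<close>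
  define a where "a s T = push_rg G (P T) (\<lambda>\<gamma>. if \<gamma> \<in> P T then x s (r \<gamma>) else 0)" for s T
  \<comment> \<open>Bisections are clopen here, so an atom is a finite intersection of clopen sets;
    inserting \<open>topspace X\<close> covers the case of empty support.\<close>
  have P_Int: "P T = \<Inter> (insert (topspace X) ((\<lambda>s. if s \<in> T then s else topspace X - s) ` ?S))" for T
    by (auto simp: P_def)
  have "openin X (P T)" for T
    unfolding P_Int
    using fin S cob_closedin[OF Gh_cob] cob_openin[OF Gh_cob] by (intro openin_Inter) auto
  moreover have "closedin X (P T)" for T
    unfolding P_Int
    using S cob_closedin[OF Gh_cob] cob_openin[OF Gh_cob] by (intro closedin_Inter) auto
  moreover have P_sub: "P T \<subseteq> s" if "s \<in> T" "T \<subseteq> ?S" for s T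
    using that by (auto simp: P_def)
  \<comment> \<open>A nonempty T confines its atom to a bisection. The atom of the empty set may
    fail to be compact, but it will index an empty sum.\<close>
  ultimately have P_Gh: "P T \<in> Gh G c" if "s \<in> T" "T \<subseteq> ?S" for s T
    using that Gh_subset[OF S, of s "P T"] by blast
  have a_apply: "a s T (r \<gamma>) = x s (r \<gamma>)" if "s \<in> T" "T \<subseteq> ?S" "\<gamma> \<in> P T" for s T \<gamma>
    using that(3) by (simp add: a_def push_rg_apply[OF P_Gh[OF that(1,2)] that(3)])
  have a_out: "a s T z = 0" if "z \<notin> r ` P T" for s T z
    using push_rg_outside that by (simp add: a_def)
  have a_Aideal: "a s T \<in> Aideal G U (P T)" if "s \<in> T" "T \<subseteq> ?S" for s T
  proof -
    have "x s \<in> Aideal G U s"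
      using skewL_Aideal[OF x] .
    then show ?thesis
      unfolding a_def using P_Gh[OF that] Gh_pullback(1)[OF P_Gh[OF that], of "x s"] Gh_arrows[OF P_Gh[OF that]]
      by (intro push_rg_Aideal) (auto simp: steinberg_iff Aideal_iff GU_iff)
  qed
  \<comment> \<open>Moves the piece of \<open>x s\<close> over the atom from s to the atom. It is
    the negative of a generator, the atom being the smaller set.\<close>
  define N where "N s T = skew_add (skew_delta s (a s T)) (skew_neg (skew_delta (P T) (a s T)))" for s T
  have N_in: "N s T \<in> skewN G c U" if "s \<in> T" "T \<subseteq> ?S" for s T
  proof -
    have sw: "skew_neg (skew_add (skew_delta (P T) (a s T)) (skew_neg (skew_delta s (a s T)))) = N s T"
      by (simp add: N_def skew_neg_def skew_add_def fun_eq_iff)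
    have "s \<in> Gh G c"
      using that S by blast
    then show ?thesis
      using skewN.neg[OF skewN.gen[OF P_Gh[OF that] _ P_sub[OF that] a_Aideal[OF that]]] sw by simp
  qed
  \<comment> \<open>T lists exactly the members of the support that contain a given arrow of its
    atom, so the total coefficient collected at the atom is a value of the evaluation.\<close>
  have moved: "(\<Sum>s\<in>T. a s T z) = 0" if T: "T \<subseteq> ?S" for T z
  proof (cases "z \<in> r ` P T")
    case True
    then obtain \<gamma> where \<gamma>: "\<gamma> \<in> P T" "z = r \<gamma>"
      by blast
    have "(\<Sum>s\<in>T. a s T z) = (\<Sum>s\<in>T. x s (r \<gamma>))"
      using a_apply[OF _ T \<gamma>(1)] \<gamma>(2) by (intro sum.cong) auto
    also have "\<dots> = (\<Sum>s\<in>{s \<in> ?S. \<gamma> \<in> s}. x s (r \<gamma>))"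
      by (rule sum.cong) (use \<gamma>(1) T in \<open>auto simp: P_def\<close>)
    also have "\<dots> = 0"
      using fun_cong[OF ev, of \<gamma>] by (simp add: skew_eval_def)
    finally show ?thesis .
  qed (simp add: a_out)
  \<comment> \<open>The pieces of a coefficient add up to it: over z = r(\<gamma>) with \<gamma> in
    u, injectivity of r on u leaves only the atom containing \<gamma>.\<close>
  have cut: "(\<Sum>T\<in>{T \<in> Pow ?S. u \<in> T}. a u T z) = x u z" for u z
  proof (cases "u \<in> ?S \<and> z \<in> r ` u")
    case True
    then obtain \<gamma> where \<gamma>: "\<gamma> \<in> u" "z = r \<gamma>" and u: "u \<in> ?S"
      by blast
    let ?T = "{s \<in> ?S. \<gamma> \<in> s}"
    have \<gamma>P: "\<gamma> \<in> P ?T"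
      using Gh_arrows[OF S[OF u] \<gamma>(1)] by (simp add: P_def arrows_def)
    have "a u T z = 0" if T: "T \<in> {T \<in> Pow ?S. u \<in> T} - {?T}" for T
    proof (rule a_out, rule notI)
      assume "z \<in> r ` P T"
      then obtain \<gamma>' where \<gamma>': "\<gamma>' \<in> P T" "z = r \<gamma>'"
        by blast
      then have "\<gamma>' \<in> u"
        using T P_sub by blast
      then have "\<gamma>' = \<gamma>"
        using Gh_inj_r[OF S[OF u]] \<gamma> \<gamma>' by simp
      then have "T = ?T"
        using \<gamma>'(1) T by (auto simp: P_def)
      then show False
        using T by blast
    qed
    then have "(\<Sum>T\<in>{T \<in> Pow ?S. u \<in> T}. a u T z) = (\<Sum>T\<in>{?T}. a u T z)"
      using fin u \<gamma>(1) by (intro sum.mono_neutral_right) auto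
    also have "\<dots> = a u ?T z"
      by simp
    also have "\<dots> = x u z"
      unfolding \<gamma>(2) by (rule a_apply[OF _ _ \<gamma>P]) (use u \<gamma>(1) in auto)
    finally show ?thesis .
  next
    case False
    have "a u T z = 0" if "T \<in> {T \<in> Pow ?S. u \<in> T}" for T
      using that False P_sub[of u T] by (intro a_out) blast
    moreover have "x u z = 0"
      using False skewL_Aideal[OF x, of u] unfolding Aideal_iff by auto
    ultimately show ?thesis
      by simp
  qed
  \<comment> \<open>The terms at the atoms cancel by \<open>moved\<close>, and the terms at the
    original bisections reassemble by \<open>cut\<close>.\<close>
  have "x = (\<lambda>u z. \<Sum>T\<in>Pow ?S. \<Sum>s\<in>T. N s T u z)"
  proof (intro ext)
    fix u z
    have inner: "(\<Sum>s\<in>T. N s T u z) = (if u \<in> T then a u T z else 0)" if T: "T \<in> Pow ?S" for T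
    proof -
      have finT: "finite T"
        using T fin finite_subset by blast
      have "(\<Sum>s\<in>T. N s T u z) = (\<Sum>s\<in>T. if u = s then a s T z else 0) - (\<Sum>s\<in>T. if u = P T then a s T z else 0)"
        unfolding N_def skew_add_def skew_neg_def skew_delta_def
        by (subst sum_subtractf[symmetric]) (intro sum.cong, auto)
      also have "(\<Sum>s\<in>T. if u = P T then a s T z else 0) = 0"
        using moved[of T z] T by (cases "u = P T") simp_all
      finally show ?thesis
        using finT by simp
    qed
    have "(\<Sum>T\<in>Pow ?S. \<Sum>s\<in>T. N s T u z) = (\<Sum>T\<in>Pow ?S. if u \<in> T then a u T z else 0)"
      by (rule sum.cong[OF refl inner])
    also have "\<dots> = (\<Sum>T\<in>{T \<in> Pow ?S. u \<in> T}. a u T z)"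
      by (rule sum.inter_filter[symmetric]) (use fin in simp)
    finally show "x u z = (\<Sum>T\<in>Pow ?S. \<Sum>s\<in>T. N s T u z)"
      using cut by simp
  qed
  also have "\<dots> \<in> skewN G c U"
    by (intro skewN_sum N_in) auto
  finally show ?thesis .
qed

text \<open>A coset of the ideal is a fibre of evaluation because the ideal is its kernel. Hence
  every representative that \<open>qrep\<close> may pick has the same known evaluation.\<close>

lemma skew_class_eq:
  assumes x: "x \<in> skewL G c U"
  shows "skew_class G c U x = {y \<in> skewL G c U. skew_eval G y = skew_eval G x}"
proof -
  have "skew_add x (skew_neg y) \<in> skewN G c U \<longleftrightarrow> skew_eval G y = skew_eval G x" if y: "y \<in> skewL G c U" for y
  proof -
    have L: "skew_add x (skew_neg y) \<in> skewL G c U"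
      using x y by (intro skewL_add skewL_neg)
    have "skew_eval G (skew_add x (skew_neg y)) = (\<lambda>\<gamma>. skew_eval G x \<gamma> - skew_eval G y \<gamma>)"
      using x y by (simp add: skew_eval_add skew_eval_neg skewL_neg)
    then have "skew_eval G (skew_add x (skew_neg y)) = (\<lambda>_. 0) \<longleftrightarrow> skew_eval G y = skew_eval G x"
      by (auto simp: fun_eq_iff)
    then show ?thesis
      using L skewN_kernel skew_eval_kernel by blast
  qed
  then show ?thesis
    unfolding skew_class_def by blast
qed

text \<open>The bound on the support is carried along so that properties demanded of the cover, such
  as homogeneity, pass to the formal sum.\<close>

lemma skew_eval_onto_cover:
  assumes "finite F" "F \<subseteq> Gh G c" "f \<in> steinberg H" "{\<gamma>. f \<gamma> \<noteq> 0} \<subseteq> \<Union>F"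
  shows "\<exists>x\<in>skewL G c U. skew_eval G x = f \<and> skew_supp x \<subseteq> F"
  using assms
proof (induction F arbitrary: f)
  case empty
  then have "f = (\<lambda>_. 0)"
    by auto
  then show ?case
    by (intro bexI[OF _ skewL_zero]) (auto simp: skew_eval_zero fun_eq_iff, simp add: skew_zero_def)
next
  case (insert B F)
  \<comment> \<open>The remainder vanishes on B, so F alone covers its support. The
    \<open>id\<close> gives the cut-off the shape of \<open>CR_pullback\<close>.\<close>
  let ?h = "\<lambda>\<gamma>. f \<gamma> + - (if \<gamma> \<in> B then f (id \<gamma>) else 0)"
  let ?x = "skew_delta B (push_rg G B f)"
  have B: "B \<in> Gh G c" and F: "F \<subseteq> Gh G c" and f: "f \<in> CR X" "\<And>\<gamma>. f \<gamma> \<noteq> 0 \<Longrightarrow> \<gamma> \<in> GU"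
    using insert.prems by (auto simp: steinberg_iff)
  have "?h \<in> CR X"
    by (intro CR_add CR_uminus f(1)
        CR_pullback[OF cob_openin cob_compactin Hausdorff continuous_map_id] Gh_cob B)
  then have "?h \<in> steinberg H"
    using f(2) by (auto simp: steinberg_iff)
  moreover have "{\<gamma>. ?h \<gamma> \<noteq> 0} \<subseteq> \<Union>F"
    using insert.prems(3) by auto
  ultimately obtain y where y: "y \<in> skewL G c U" "skew_eval G y = ?h" "skew_supp y \<subseteq> F"
    using insert.IH[OF F] by blast
  have x: "?x \<in> skewL G c U"
    using B insert.prems by (intro skewL_delta push_rg_Aideal)
  have "skew_eval G (skew_add ?x y) = f"
    using push_rg_apply[OF B, of _ f] by (auto simp: skew_eval_add x y skew_eval_delta fun_eq_iff)
  moreover have "skew_supp (skew_add ?x y) \<subseteq> insert B F"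
    using y(3) by (auto simp: skew_add_def skew_delta_def)
  ultimately show ?case
    using skewL_add[OF x y(1)] by blast
qed

text \<open>The last clause serves the grading: each bisection in the formal sum meets the support
  of f, so for homogeneous f it is nonempty and has the degree of f.\<close>

lemma skew_eval_onto:
  assumes f: "f \<in> steinberg H"
  shows "\<exists>x\<in>skewL G c U. skew_eval G x = f \<and>
    (\<forall>s\<in>skew_supp x. \<exists>\<gamma>\<in>s. f \<gamma> \<noteq> 0 \<and> (\<forall>b\<in>s. c b = c \<gamma>))"
proof -
  let ?\<U> = "{B \<in> Gh G c. \<exists>\<gamma>\<in>B. f \<gamma> \<noteq> 0 \<and> (\<forall>b\<in>B. c b = c \<gamma>)}"
  have comp: "compactin X {\<gamma>. f \<gamma> \<noteq> 0}"
    using f by (auto simp: steinberg_iff intro: CR_compactin)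
  have "{\<gamma>. f \<gamma> \<noteq> 0} \<subseteq> \<Union>?\<U>"
  proof clarify
    fix \<gamma> assume \<gamma>: "f \<gamma> \<noteq> 0"
    then have "\<gamma> \<in> arrows G"
      using f by (auto simp: steinberg_iff GU_iff)
    moreover have "openin X {x \<in> arrows G. c x = c \<gamma>}"
      using grading by (simp add: grading_def)
    ultimately obtain B where "cob B" "\<gamma> \<in> B" "B \<subseteq> {x \<in> arrows G. c x = c \<gamma>}"
      using cob_subset_exists by (metis (mono_tags, lifting) mem_Collect_eq)
    then show "\<gamma> \<in> \<Union>?\<U>"
      using \<gamma> by (intro UnionI[of B]) (auto simp: Gh_iff)
  qed
  moreover have "openin X B" if "B \<in> ?\<U>" for B
    using that cob_openin[OF Gh_cob] by blast
  ultimately have "\<exists>F. finite F \<and> F \<subseteq> ?\<U> \<and> {\<gamma>. f \<gamma> \<noteq> 0} \<subseteq> \<Union>F"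
    by (intro compactinD[OF comp])
  then obtain F where F: "finite F" "F \<subseteq> ?\<U>" "{\<gamma>. f \<gamma> \<noteq> 0} \<subseteq> \<Union>F"
    by (elim exE conjE)
  moreover from F(2) have "F \<subseteq> Gh G c"
    by blast
  ultimately obtain x where "x \<in> skewL G c U" "skew_eval G x = f" "skew_supp x \<subseteq> F"
    using skew_eval_onto_cover[OF _ _ f] by blast
  then show ?thesis
    using F(2) by blast
qed

text \<open>The reduction is an open subset of the groupoid and its unit space is U, again open; so
  openness and compactness transfer to the whole groupoid.\<close>

lemma compact_open_bisection_reduce:
  assumes D: "compact_open_bisection H D"
  shows "cob D" "D \<subseteq> GU"
proof -
  have oD: "openin (subtopology X GU) D" "compactin (subtopology X GU) D"
    using D by (auto simp: compact_open_bisection_def bisection_def gtop_reduce)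
  then show DGU: "D \<subseteq> GU"
    by (simp add: compactin_subtopology)
  have units_H: "units H = U"
  proof -
    have "u \<in> d ` GU" if "u \<in> U" for u
      using that U_subset d_unit[of u] units_arrows by (intro image_eqI[of _ _ u]) (auto simp: GU_def)
    then show ?thesis
      by (auto simp: units_def arrows_reduce) (auto simp: GU_def)
  qed
  have "U \<subseteq> GU"
    using U_subset d_unit units_arrows by (auto simp: GU_def)
  then have "subtopology (gtop H) (units H) = subtopology X U"
    by (simp add: gtop_reduce units_H subtopology_subtopology inf_absorb2)
  then have im: "openin X (d ` D)" "openin X (r ` D)"
    using D openin_trans_full[OF _ openin_U] by (auto simp: compact_open_bisection_def bisection_def)
  have "topspace (subtopology (gtop H) D) = D"
    using D openin_subset by (fastforce simp: compact_open_bisection_def bisection_def)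
  then have "inj_on d D" "inj_on r D"
    using D homeomorphic_imp_injective_map unfolding compact_open_bisection_def bisection_def by fastforce+
  then show "cob D"
    using oD im openin_trans_full[OF _ openin_GU] by (intro cob_I) (auto simp: compactin_subtopology)
qed

lemma indicator_steinberg:
  assumes D: "cob D" "D \<subseteq> GU"
  shows "(indicator D :: 'a \<Rightarrow> 'r::comm_ring_1) \<in> steinberg H"
  unfolding steinberg_iff
proof
  show "(indicator D :: 'a \<Rightarrow> 'r) \<in> CR X"
  proof (rule CR_I[OF _ _ cob_compactin[OF D(1)]])
    show "\<exists>V. openin X V \<and> x \<in> V \<and> (\<forall>y\<in>V. indicator D y = (indicator D x :: 'r))" if "x \<in> topspace X" for x
    proof (cases "x \<in> D")
      case True
      then show ?thesis
        using cob_openin[OF D(1)] by (intro exI[of _ D]) simp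
    next
      case False
      then show ?thesis
        using that cob_closedin[OF D(1)] by (intro exI[of _ "topspace X - D"]) auto
    qed
  qed (use cob_arrows[OF D(1)] in \<open>auto simp: indicator_def arrows_def\<close>)
qed (use D(2) in \<open>auto simp: indicator_def\<close>)

section \<open>The graded isomorphism\<close>

definition skew_fibre :: "('a \<Rightarrow> 'r::comm_ring_1) \<Rightarrow> ('a set \<Rightarrow> 'a \<Rightarrow> 'r) set" where
  "skew_fibre f = {y \<in> skewL G c U. skew_eval G y = f}"

lemma skew_fibre_eval: "x \<in> skewL G c U \<Longrightarrow> skew_fibre (skew_eval G x) = skew_class G c U x"
  by (simp add: skew_fibre_def skew_class_eq)

text \<open>Surjectivity of evaluation makes the fibre nonempty, so the choice in
  \<open>qrep\<close> is meaningful and recovers f. Injectivity of \<open>skew_fibre\<close> and its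
  compatibility with the operations rest on this.\<close>

lemma qrep_skew_fibre:
  assumes "f \<in> steinberg H"
  shows "qrep (skew_fibre f) \<in> skewL G c U" "skew_eval G (qrep (skew_fibre f)) = f"
proof -
  have "\<exists>x. x \<in> skew_fibre f"
    using skew_eval_onto[OF assms] by (auto simp: skew_fibre_def)
  then have "qrep (skew_fibre f) \<in> skew_fibre f"
    unfolding qrep_def by (rule someI_ex)
  then show "qrep (skew_fibre f) \<in> skewL G c U" "skew_eval G (qrep (skew_fibre f)) = f"
    by (auto simp: skew_fibre_def)
qed

lemma skew_fibre_bij: "bij_betw skew_fibre (steinberg H) (skew_quot G c U)"
  unfolding bij_betw_def
proof
  show "inj_on skew_fibre (steinberg H)"
    using qrep_skew_fibre(2) by (metis inj_onI)
  show "skew_fibre ` steinberg H = skew_quot G c U"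
  proof (intro subset_antisym image_subsetI)
    fix f assume "f \<in> steinberg H"
    then show "skew_fibre f \<in> skew_quot G c U"
      using qrep_skew_fibre skew_fibre_eval unfolding skew_quot_def by (metis imageI)
  next
    show "skew_quot G c U \<subseteq> skew_fibre ` steinberg H"
      unfolding skew_quot_def using skew_fibre_eval skew_eval_steinberg by force
  qed
qed

lemma skew_fibre_add:
  assumes "f \<in> steinberg H" "h \<in> steinberg H"
  shows "skew_fibre (\<lambda>x. f x + h x) = quot_add G c U (skew_fibre f) (skew_fibre h)"
  using skew_fibre_eval[OF skewL_add, of "qrep (skew_fibre f)" "qrep (skew_fibre h)"] assms
  by (simp add: quot_add_def qrep_skew_fibre skew_eval_add)

lemma skew_fibre_smul:
  assumes "f \<in> steinberg H"
  shows "skew_fibre (\<lambda>x. k * f x) = quot_smul G c U k (skew_fibre f)"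
  using skew_fibre_eval[OF skewL_smul, of "qrep (skew_fibre f)" k] assms
  by (simp add: quot_smul_def qrep_skew_fibre skew_eval_smul)

lemma skew_fibre_conv:
  assumes "f \<in> steinberg H" "h \<in> steinberg H"
  shows "skew_fibre (conv H f h) = quot_mult G c U (skew_fibre f) (skew_fibre h)"
  using skew_fibre_eval[OF skewL_mult, of "qrep (skew_fibre f)" "qrep (skew_fibre h)"] assms
  by (simp add: quot_mult_def qrep_skew_fibre skew_eval_mult)

text \<open>A homogeneous formal sum evaluates to zero off the arrows of its degree. The converse
  uses the control of the support in \<open>skew_eval_onto\<close>.\<close>

lemma skew_fibre_deg: "skew_fibre ` steinberg_deg H c g = (quot_deg G c U g :: ('a set \<Rightarrow> 'a \<Rightarrow> 'r::comm_ring_1) set set)"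
proof (intro subset_antisym image_subsetI)
  fix f :: "'a \<Rightarrow> 'r" assume f: "f \<in> steinberg_deg H c g"
  then obtain x where x: "x \<in> skewL G c U" "skew_eval G x = f"
    and s: "\<And>s. s \<in> skew_supp x \<Longrightarrow> \<exists>\<gamma>\<in>s. f \<gamma> \<noteq> 0 \<and> (\<forall>b\<in>s. c b = c \<gamma>)"
    using skew_eval_onto[of f] by (auto simp: steinberg_deg_def)
  have "s \<noteq> {} \<and> (\<forall>b\<in>s. c b = g)" if nz: "x s \<noteq> (\<lambda>_. 0)" for s
  proof -
    obtain \<gamma> where "\<gamma> \<in> s" "f \<gamma> \<noteq> 0" "\<forall>b\<in>s. c b = c \<gamma>"
      using s[of s] nz by blast
    moreover have "c \<gamma> = g"
      using f calculation(2) by (simp add: steinberg_deg_def)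
    ultimately show ?thesis
      by auto
  qed
  then have "x \<in> skewL_deg G c U g"
    using x by (simp add: skewL_deg_def)
  then show "skew_fibre f \<in> quot_deg G c U g"
    using skew_fibre_eval[OF x(1)] x(2) by (simp add: quot_deg_def)
next
  show "(quot_deg G c U g :: ('a set \<Rightarrow> 'a \<Rightarrow> 'r) set set) \<subseteq> skew_fibre ` steinberg_deg H c g"
    unfolding quot_deg_def
  proof (rule image_subsetI)
    fix x :: "'a set \<Rightarrow> 'a \<Rightarrow> 'r" assume "x \<in> skewL_deg G c U g"
    then have x: "x \<in> skewL G c U" and deg: "\<And>s. s \<in> skew_supp x \<Longrightarrow> \<forall>b\<in>s. c b = g"
      by (auto simp: skewL_deg_def)
    have "c \<gamma> = g" if nz: "skew_eval G x \<gamma> \<noteq> 0" for \<gamma>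
    proof -
      have "{s \<in> skew_supp x. \<gamma> \<in> s} \<noteq> {}"
        using nz unfolding skew_eval_def by (metis (no_types, lifting) sum.empty)
      then show ?thesis
        using deg by blast
    qed
    then have "skew_eval G x \<in> steinberg_deg H c g"
      using skew_eval_steinberg[OF x] by (simp add: steinberg_deg_def)
    then show "skew_class G c U x \<in> skew_fibre ` steinberg_deg H c g"
      using skew_fibre_eval[OF x] by (metis imageI)
  qed
qed

lemma skew_fibre_indicator:
  assumes D: "compact_open_bisection H D" and g: "\<forall>b\<in>D. c b = g"
  shows "skew_fibre (indicator D) =
    skew_class G c U (skew_delta D (indicator (r ` D) :: 'a \<Rightarrow> 'r::comm_ring_1))"
proof -
  note D' = compact_open_bisection_reduce[OF D]
  have DG: "D \<in> Gh G c"
    using D'(1) g by (auto simp: Gh_iff)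
  \<comment> \<open>The function 1 on r(D) is the push-forward of the indicator of D, and its
    membership in the ideal comes from there.\<close>
  have "push_rg G D (indicator D :: 'a \<Rightarrow> 'r) z = indicator (r ` D) z" for z
    by (cases "z \<in> r ` D") (auto simp: push_rg_apply[OF DG] push_rg_outside)
  then have "push_rg G D (indicator D :: 'a \<Rightarrow> 'r) = indicator (r ` D)"
    by blast
  then have "(indicator (r ` D) :: 'a \<Rightarrow> 'r) \<in> Aideal G U D"
    using push_rg_Aideal[OF DG indicator_steinberg[OF D']] by metis
  then have L: "skew_delta D (indicator (r ` D) :: 'a \<Rightarrow> 'r) \<in> skewL G c U"
    by (rule skewL_delta[OF DG])
  have "skew_eval G (skew_delta D (indicator (r ` D) :: 'a \<Rightarrow> 'r)) = indicator D"
    by (auto simp: fun_eq_iff skew_eval_delta indicator_def)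
  then show ?thesis
    using skew_fibre_eval[OF L] by simp
qed

end

theorem mainTheorem1:
  fixes G :: "'a gpd" and c :: "'a \<Rightarrow> 'g::group_add" and U :: "'a set"
  assumes "topological_groupoid G"
    and "ample G"
    and "Hausdorff_space (gtop G)"
    and "grading G c"
    and "U \<subseteq> units G"
    and "openin (subtopology (gtop G) (units G)) U"
    and "invariant G U"
  shows "\<exists>\<Phi> :: ('a \<Rightarrow> 'r::comm_ring_1) \<Rightarrow> ('a set \<Rightarrow> 'a \<Rightarrow> 'r) set.
     bij_betw \<Phi> (steinberg (reduce G U)) (skew_quot G c U) \<and>
     (\<forall>f\<in>steinberg (reduce G U). \<forall>h\<in>steinberg (reduce G U).
        \<Phi> (\<lambda>x. f x + h x) = quot_add G c U (\<Phi> f) (\<Phi> h)) \<and>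
     (\<forall>k. \<forall>f\<in>steinberg (reduce G U). \<Phi> (\<lambda>x. k * f x) = quot_smul G c U k (\<Phi> f)) \<and>
     (\<forall>f\<in>steinberg (reduce G U). \<forall>h\<in>steinberg (reduce G U).
        \<Phi> (conv (reduce G U) f h) = quot_mult G c U (\<Phi> f) (\<Phi> h)) \<and>
     (\<forall>g. \<Phi> ` steinberg_deg (reduce G U) c g = quot_deg G c U g) \<and>
     (\<forall>D. compact_open_bisection (reduce G U) D \<and> (\<exists>g. \<forall>b\<in>D. c b = g) \<longrightarrow>
        \<Phi> (indicator D) = skew_class G c U (skew_delta D (indicator (rg G ` D))))"
proof -
  interpret graded_ample_groupoid G c U
    using assms by unfold_locales
  show ?thesis
    by (intro exI[of _ skew_fibre] conjI allI ballI impI; (elim exE conjE)?;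
        rule skew_fibre_bij skew_fibre_deg skew_fibre_add skew_fibre_smul skew_fibre_conv
          skew_fibre_indicator; assumption)
qed

end
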